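(* The topology $\vartheta$ on $\mathcal M(\mathcal I)$ is metrizable and compact. Moreover, (1) for every open set $O\subset\mathcal I$, the mapping $\mathcal M(\mathcal I)\to[0,\infty]:m\mapsto m(O)$ is lower semicontinuous; (2) for every compact set $K\subset\mathcal I$, the mapping $\mathcal M(\mathcal I)\to[0,\infty]:m\mapsto m(K)$ is upper semicontinuous; (3) a sequence $(m_n)_{n\ge0}$ in $\mathcal M(\mathcal I)$ converges to $m\in\mathcal M(\mathcal I)$ if and only if - for every open set $O\subset\mathcal I$ such that $O\cap e(m)\neq\emptyset$, $m_n(O)\to\infty$; and - letting $L_\phi(m):=\int_{\mathcal I}\phi\,\mathrm dm$, $L_\phi(m_n)\to L_\phi(m)$ for all $\phi\in\mathcal C_c^+(\mathcal I\setminus e(m))$.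
   Context: $\mathcal I=(\alpha,\beta)\subset\mathbb R$ is an open interval, $-\infty\le\alpha<\beta\le\infty$, with Borel $\sigma$-field $\mathcal B(\mathcal I)$. $\mathcal M(\mathcal I)$ is the set of nonnegative, regular, not necessarily finite (nor locally finite) measures $m:\mathcal B(\mathcal I)\to[0,\infty]$, where regular means that for every $A\in\mathcal B(\mathcal I)$, $m(A)=\inf\{m(O):A\subset O,\ O\text{ open}\}=\sup\{m(K):K\subset A,\ K\text{ compact}\}$. $\vartheta$ is the coarsest topology on $\mathcal M(\mathcal I)$ such that $m\mapsto m((a,b))\in[0,\infty]$ is lower semicontinuous for all $a,b\in\mathcal I\cap\mathbb Q$ with $a<b$, and $m\mapsto m([a,b])\in[0,\infty]$ is upper semicontinuous for all $a,b\in\mathcal I\cap\mathbb Q$ with $a\le b$. The explosion set of $m$ is $e(m)=\{x\in\mathcal I:\forall\varepsilon>0,\ m((x-\varepsilon,x+\varepsilon)\cap\mathcal I)=\infty\}$, a closed subset of $\mathcal I$. For $U\subset\mathcal I$ open, $\mathcal C_c^+(U)$ is the set of nonnegative continuous functions with compact support contained in $U$ (extended by $0$ to $\mathcal I$). *)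

theory Defs
  imports "HOL-Analysis.Analysis"
begin

definition lower_semicont :: "'a topology \<Rightarrow> ('a \<Rightarrow> ennreal) \<Rightarrow> bool" where
  "lower_semicont T f \<longleftrightarrow> (\<forall>c. openin T {x \<in> topspace T. c < f x})"

definition upper_semicont :: "'a topology \<Rightarrow> ('a \<Rightarrow> ennreal) \<Rightarrow> bool" where
  "upper_semicont T f \<longleftrightarrow> (\<forall>c. openin T {x \<in> topspace T. f x < c})"

text \<open>
  The state space \<open>I\<close> is always an open subset of the real line, so its Borel \<open>\<sigma>\<close>-field is that of
  \<open>restrict_space borel I\<close>, and the open subsets of \<open>I\<close> are the open subsets of the line
  contained in \<open>I\<close>.
\<close>

definition regular_measures :: "real set \<Rightarrow> real measure set" where
  "regular_measures I =
    {m. sets m = sets (restrict_space borel I) \<and>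
        (\<forall>A\<in>sets m.
           emeasure m A = (INF U\<in>{U. open U \<and> U \<subseteq> I \<and> A \<subseteq> U}. emeasure m U) \<and>
           emeasure m A = (SUP K\<in>{K. compact K \<and> K \<subseteq> A}. emeasure m K))}"

text \<open>
  The carrier is included among the generators so that it is the underlying set by
  construction.  That this topology is the coarsest one with the required
  semicontinuity is proved in \<open>vtheta_semicont\<close> and \<open>vtheta_coarsest\<close>.
\<close>

definition vtheta :: "real set \<Rightarrow> real measure topology" where
  "vtheta I = topology_generated_by
     (insert (regular_measures I)
       ({{m \<in> regular_measures I. c < emeasure m {a<..<b}} | a b c.
            a \<in> I \<inter> \<rat> \<and> b \<in> I \<inter> \<rat> \<and> a < b} \<union>
        {{m \<in> regular_measures I. emeasure m {a..b} < c} | a b c.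
            a \<in> I \<inter> \<rat> \<and> b \<in> I \<inter> \<rat> \<and> a \<le> b}))"

definition explosion_set :: "real measure \<Rightarrow> real set" where
  "explosion_set m =
    {x \<in> space m. \<forall>\<epsilon>>0. emeasure m ({x - \<epsilon><..<x + \<epsilon>} \<inter> space m) = \<infinity>}"

text \<open>
  Functions are extended by \<open>0\<close> to the whole line.  For such a function the
  closure of \<open>{x. \<phi> x \<noteq> 0}\<close> relative to \<open>U\<close> is compact iff its closure in the line
  is compact and contained in \<open>U\<close>, and then both closures agree.
\<close>

definition Cc_plus :: "real set \<Rightarrow> (real \<Rightarrow> real) set" where
  "Cc_plus U =
    {\<phi>. continuous_on U \<phi> \<and> (\<forall>x. 0 \<le> \<phi> x) \<and>
        compact (closure {x. \<phi> x \<noteq> 0}) \<and> closure {x. \<phi> x \<noteq> 0} \<subseteq> U}"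

lemma topspace_vtheta [simp]: "topspace (vtheta I) = regular_measures I"
  unfolding vtheta_def topology_generated_by_topspace by auto

lemma vtheta_semicont:
  assumes "a \<in> I \<inter> \<rat>" "b \<in> I \<inter> \<rat>"
  shows "a < b \<Longrightarrow> lower_semicont (vtheta I) (\<lambda>m. emeasure m {a<..<b})"
    and "a \<le> b \<Longrightarrow> upper_semicont (vtheta I) (\<lambda>m. emeasure m {a..b})"
proof -
  show "lower_semicont (vtheta I) (\<lambda>m. emeasure m {a<..<b})" if "a < b"
    unfolding lower_semicont_def topspace_vtheta
    unfolding vtheta_def using assms that
    by (intro allI topology_generated_by_Basis) blast
  show "upper_semicont (vtheta I) (\<lambda>m. emeasure m {a..b})" if "a \<le> b"
    unfolding upper_semicont_def topspace_vtheta
    unfolding vtheta_def using assms that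
    by (intro allI topology_generated_by_Basis) blast
qed

lemma vtheta_coarsest:
  assumes T: "topspace T = regular_measures I"
    and lower: "\<And>a b. \<lbrakk>a \<in> I \<inter> \<rat>; b \<in> I \<inter> \<rat>; a < b\<rbrakk>
                  \<Longrightarrow> lower_semicont T (\<lambda>m. emeasure m {a<..<b})"
    and upper: "\<And>a b. \<lbrakk>a \<in> I \<inter> \<rat>; b \<in> I \<inter> \<rat>; a \<le> b\<rbrakk>
                  \<Longrightarrow> upper_semicont T (\<lambda>m. emeasure m {a..b})"
    and V: "openin (vtheta I) V"
  shows "openin T V"
proof -
  have base: "openin T (regular_measures I)"
    using T openin_topspace by metis
  let ?S = "insert (regular_measures I)
       ({{m \<in> regular_measures I. c < emeasure m {a<..<b}} | a b c.
            a \<in> I \<inter> \<rat> \<and> b \<in> I \<inter> \<rat> \<and> a < b} \<union>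
        {{m \<in> regular_measures I. emeasure m {a..b} < c} | a b c.
            a \<in> I \<inter> \<rat> \<and> b \<in> I \<inter> \<rat> \<and> a \<le> b})"
  have gen: "generate_topology_on ?S V"
    using V unfolding vtheta_def by (rule openin_topology_generated_by)
  show ?thesis
  proof (rule generate_topology_on_coarsest[OF istopology_openin _ gen])
    fix s assume "s \<in> ?S"
    then consider "s = regular_measures I"
      | a b c where "s = {m \<in> regular_measures I. c < emeasure m {a<..<b}}"
          "a \<in> I \<inter> \<rat>" "b \<in> I \<inter> \<rat>" "a < b"
      | a b c where "s = {m \<in> regular_measures I. emeasure m {a..b} < c}"
          "a \<in> I \<inter> \<rat>" "b \<in> I \<inter> \<rat>" "a \<le> b"
      by blast
    then show "openin T s"
    proof cases
      case 1
      then show ?thesis using base by simp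
    next
      case 2
      then show ?thesis using lower T unfolding lower_semicont_def by metis
    next
      case 3
      then show ?thesis using upper T unfolding upper_semicont_def by metis
    qed
  qed
qed

end

theory Submission
  imports Defs
begin

text \<open>
  A regular measure is determined by its values on compact sets, and these values form a
  content: a monotone, subadditive set function that is additive on disjoint compact sets.
  Conversely, every content \<open>\<nu>\<close> on the compact subsets of \<open>I\<close> induces a regular measure, by
  approximating open sets from inside by compact sets and arbitrary sets from outside by open
  sets.  No finiteness is needed for this: Caratheodory's theorem yields a Borel measure that is
  outer regular by construction, and outer regularity alone entails inner regularity
  (\<open>inner_regular_if_outer_regular\<close>), because a Borel set either contains a point of infinite
  mass, and this point is compact, or is covered by countably many open sets of finite mass.

  The contents form a closed subset of the compact space of all functions from sets to
  \<open>[0, \<infinity>]\<close>, and the map from contents to measures is continuous and surjective.  Hence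
  \<open>vtheta I\<close> is compact.  It is Hausdorff because a regular measure is determined by its
  values on rational intervals: open sets are disjoint unions of open intervals, and the mass
  of an interval is a supremum over compact intervals (\<open>regular_measures_le\<close>).  A continuous
  surjection from a compact space onto a Hausdorff space is a quotient map, so semicontinuity
  of \<open>m \<mapsto> m(O)\<close> and \<open>m \<mapsto> m(K)\<close> may be checked on contents, where it is immediate.
  Countably many Urysohn functions, one for each suitable pair of rational intervals, separate
  the points of the normal space \<open>vtheta I\<close> and embed it into a countable product of real lines.

  If \<open>m\<^sub>n\<close> converges to \<open>m\<close>, then lower semicontinuity gives the explosion of \<open>m\<^sub>n(O)\<close>, since
  \<open>m(O) = \<infinity>\<close> for each open \<open>O\<close> that meets the explosion set.  Away from the explosion set,
  compact sets have finite mass, and an integral of a compactly supported function lies, up to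
  an arbitrarily small error, between sums of masses of open and of compact superlevel sets
  (\<open>nn_integral_levels\<close>).  Conversely, bump functions recover the subbasic inequalities.
\<close>

section \<open>Compact sets in open sets\<close>

lemma compact_nhd_within_open:
  fixes K U :: "real set"
  assumes "compact K" "open U" "K \<subseteq> U"
  obtains L where "compact L" "K \<subseteq> interior L" "L \<subseteq> U"
proof (cases "K = {}")
  case True
  show ?thesis by (rule that[of "{}"]) (use True in auto)
next
  case False
  from compact_in_open_separated[OF False assms] obtain e
    where e: "e > 0" "{x. infdist x K \<le> e} \<subseteq> U" by blast
  have "open {x. infdist x K < e}"
    by (intro open_Collect_less continuous_intros)
  moreover have "K \<subseteq> {x. infdist x K < e}"
    using e by auto
  ultimately have "K \<subseteq> interior {x. infdist x K \<le> e}"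
    by (intro interior_maximal[THEN order_trans[rotated]]) auto
  then show ?thesis
    using that compact_infdist_le[OF False assms(1) e(1)] e(2) by blast
qed

lemma compact_split_open_cover:
  fixes K U V :: "real set"
  assumes "compact K" "open U" "open V" "K \<subseteq> U \<union> V"
  obtains K1 K2 where "compact K1" "compact K2" "K = K1 \<union> K2" "K1 \<subseteq> U" "K2 \<subseteq> V"
proof -
  have "compact (K - V)" "K - V \<subseteq> U"
    using assms by (auto intro: compact_diff)
  then obtain L where L: "compact L" "K - V \<subseteq> interior L" "L \<subseteq> U"
    using compact_nhd_within_open assms by metis
  show ?thesis
    by (rule that[of "K \<inter> L" "K - interior L"])
      (use L assms interior_subset[of L] in \<open>auto intro: compact_diff\<close>)
qed

section \<open>The regular measure induced by a content\<close>

text \<open>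
  Contents on the compact subsets of \<open>I\<close>.  They are total functions on sets of reals, so that
  they live in a product space; their values on all other sets are unconstrained.
\<close>

definition contents :: "real set \<Rightarrow> (real set \<Rightarrow> ennreal) set" where
  "contents I = {\<nu>. \<nu> {} = 0 \<and>
     (\<forall>K L. compact K \<and> compact L \<and> K \<subseteq> I \<and> L \<subseteq> I \<longrightarrow>
        (K \<subseteq> L \<longrightarrow> \<nu> K \<le> \<nu> L) \<and>
        \<nu> (K \<union> L) \<le> \<nu> K + \<nu> L \<and>
        (K \<inter> L = {} \<longrightarrow> \<nu> (K \<union> L) = \<nu> K + \<nu> L))}"

text \<open>
  The inner content is meant for open sets: it is the supremum over the compact subsets.
\<close>

definition inner_content :: "(real set \<Rightarrow> ennreal) \<Rightarrow> real set \<Rightarrow> ennreal" where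
  "inner_content \<nu> U = (SUP K\<in>{K. compact K \<and> K \<subseteq> U}. \<nu> K)"

text \<open>
  The outer measure induced by the inner contents of the open subsets of \<open>I\<close>.  A set that is not
  contained in \<open>I\<close> gets the infimum \<open>\<infinity>\<close> of the empty family.
\<close>

definition outer_content :: "real set \<Rightarrow> (real set \<Rightarrow> ennreal) \<Rightarrow> real set \<Rightarrow> ennreal" where
  "outer_content I \<nu> A = (INF U\<in>{U. open U \<and> U \<subseteq> I \<and> A \<subseteq> U}. inner_content \<nu> U)"

lemma inner_content_mono: "U \<subseteq> V \<Longrightarrow> inner_content \<nu> U \<le> inner_content \<nu> V"
  unfolding inner_content_def by (intro SUP_subset_mono) auto

lemma content_le_inner: "compact K \<Longrightarrow> K \<subseteq> U \<Longrightarrow> \<nu> K \<le> inner_content \<nu> U"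
  unfolding inner_content_def by (intro SUP_upper) auto

lemma inner_le_content:
  "\<nu> \<in> contents I \<Longrightarrow> compact K \<Longrightarrow> K \<subseteq> I \<Longrightarrow> U \<subseteq> K \<Longrightarrow> inner_content \<nu> U \<le> \<nu> K"
  unfolding inner_content_def contents_def by (intro SUP_least) auto

lemma inner_content_Un_le:
  assumes \<nu>: "\<nu> \<in> contents I" and U: "open U" "U \<subseteq> I" and V: "open V" "V \<subseteq> I"
  shows "inner_content \<nu> (U \<union> V) \<le> inner_content \<nu> U + inner_content \<nu> V"
  unfolding inner_content_def[of \<nu> "U \<union> V"]
proof (rule SUP_least)
  fix K assume "K \<in> {K. compact K \<and> K \<subseteq> U \<union> V}"
  then have "compact K" "K \<subseteq> U \<union> V" by auto
  from compact_split_open_cover[OF this(1) U(1) V(1) this(2)]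
  obtain K1 K2 where K: "compact K1" "compact K2" "K = K1 \<union> K2" "K1 \<subseteq> U" "K2 \<subseteq> V"
    by blast
  moreover have "K1 \<subseteq> I" "K2 \<subseteq> I" using K U V by auto
  ultimately have "\<nu> K \<le> \<nu> K1 + \<nu> K2"
    using \<nu> unfolding contents_def by auto
  also have "\<dots> \<le> inner_content \<nu> U + inner_content \<nu> V"
    using K by (intro add_mono content_le_inner)
  finally show "\<nu> K \<le> inner_content \<nu> U + inner_content \<nu> V" .
qed

lemma inner_content_UN_le:
  fixes U :: "nat \<Rightarrow> real set"
  assumes \<nu>: "\<nu> \<in> contents I" and U: "\<And>i. open (U i)" "\<And>i. U i \<subseteq> I"
  shows "inner_content \<nu> (\<Union>i. U i) \<le> (\<Sum>i. inner_content \<nu> (U i))"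
  unfolding inner_content_def[of \<nu> "\<Union>i. U i"]
proof (rule SUP_least)
  fix K assume "K \<in> {K. compact K \<and> K \<subseteq> (\<Union>i. U i)}"
  then have K: "compact K" "K \<subseteq> (\<Union>i\<in>UNIV. U i)" by auto
  obtain J where J: "finite J" "K \<subseteq> (\<Union>i\<in>J. U i)"
    using compactE_image[OF K(1), of UNIV U] K(2) U by metis
  have fin: "inner_content \<nu> (\<Union>i\<in>J. U i) \<le> (\<Sum>i\<in>J. inner_content \<nu> (U i))"
    using J(1)
  proof induction
    case empty
    then show ?case using \<nu> by (auto simp: inner_content_def contents_def)
  next
    case (insert j J)
    have "inner_content \<nu> (U j \<union> (\<Union>i\<in>J. U i))
        \<le> inner_content \<nu> (U j) + inner_content \<nu> (\<Union>i\<in>J. U i)"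
      using U by (intro inner_content_Un_le[OF \<nu>]) auto
    also have "\<dots> \<le> inner_content \<nu> (U j) + (\<Sum>i\<in>J. inner_content \<nu> (U i))"
      by (intro add_mono insert order_refl)
    finally show ?case using insert by simp
  qed
  have "\<nu> K \<le> inner_content \<nu> (\<Union>i\<in>J. U i)" using K J by (intro content_le_inner)
  also note fin
  also have "(\<Sum>i\<in>J. inner_content \<nu> (U i)) \<le> (\<Sum>i. inner_content \<nu> (U i))"
    by (intro sum_le_suminf J) auto
  finally show "\<nu> K \<le> (\<Sum>i. inner_content \<nu> (U i))" .
qed

lemma outer_content_open: "open U \<Longrightarrow> U \<subseteq> I \<Longrightarrow> outer_content I \<nu> U = inner_content \<nu> U"
  unfolding outer_content_def
  by (intro antisym INF_greatest INF_lower inner_content_mono) auto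

lemma outer_content_mono: "A \<subseteq> B \<Longrightarrow> outer_content I \<nu> A \<le> outer_content I \<nu> B"
  unfolding outer_content_def by (intro INF_superset_mono) auto

lemma outer_content_less_iff:
  "outer_content I \<nu> A < c \<longleftrightarrow> (\<exists>U. open U \<and> U \<subseteq> I \<and> A \<subseteq> U \<and> inner_content \<nu> U < c)"
  unfolding outer_content_def by (auto simp: INF_less_iff)

lemma countably_subadditive_outer_content:
  assumes \<nu>: "\<nu> \<in> contents I"
  shows "countably_subadditive (Pow I) (outer_content I \<nu>)"
  unfolding countably_subadditive_def
proof safe
  fix A :: "nat \<Rightarrow> real set"
  let ?O = "outer_content I \<nu>"
  show "?O (\<Union>i. A i) \<le> (\<Sum>n. ?O (A n))"
  proof (rule ennreal_le_epsilon)
    fix b and e :: real assume "0 < e" "(\<Sum>n. ?O (A n)) < top"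
    then have *: "\<And>n. ?O (A n) < ?O (A n) + e * (1/2)^Suc n"
      by (auto simp add: less_top dest!: ennreal_suminf_lessD)
    have "\<forall>n. \<exists>U. open U \<and> U \<subseteq> I \<and> A n \<subseteq> U \<and> inner_content \<nu> U < ?O (A n) + e * (1/2)^Suc n"
      using *[unfolded outer_content_less_iff[of I \<nu> "A _"]] by blast
    then obtain U where U: "\<And>n. open (U n)" "\<And>n. U n \<subseteq> I" "\<And>n. A n \<subseteq> U n"
        and less: "\<And>n. inner_content \<nu> (U n) < ?O (A n) + e * (1/2)^Suc n"
      by metis
    have "?O (\<Union>i. A i) \<le> inner_content \<nu> (\<Union>i. U i)"
      unfolding outer_content_def using U by (intro INF_lower) blast
    also have "\<dots> \<le> (\<Sum>i. inner_content \<nu> (U i))"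
      by (intro inner_content_UN_le[OF \<nu>] U)
    also have "\<dots> \<le> (\<Sum>n. ?O (A n) + e * (1/2) ^ Suc n)"
      using less by (intro suminf_le allI) (auto simp: less_imp_le)
    also have "... = (\<Sum>n. ?O (A n)) + (\<Sum>n. ennreal e * ennreal ((1/2) ^ Suc n))"
      using \<open>0 < e\<close> by (subst suminf_add[symmetric])
                       (auto simp del: ennreal_suminf_cmult simp add: ennreal_mult[symmetric])
    also have "\<dots> = (\<Sum>n. ?O (A n)) + e"
      unfolding ennreal_suminf_cmult
      by (subst suminf_ennreal_eq[OF zero_le_power power_half_series]) auto
    finally show "?O (\<Union>i. A i) \<le> (\<Sum>n. ?O (A n)) + e" .
  qed
qed

lemma outer_measure_space_outer_content:
  assumes "open I" "\<nu> \<in> contents I"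
  shows "outer_measure_space (Pow I) (outer_content I \<nu>)"
  unfolding outer_measure_space_def
proof (intro conjI countably_subadditive_outer_content assms)
  have "inner_content \<nu> {} = 0"
    using assms by (auto simp: inner_content_def contents_def)
  then show "positive (Pow I) (outer_content I \<nu>)"
    by (simp add: positive_def outer_content_open)
  show "increasing (Pow I) (outer_content I \<nu>)"
    by (simp add: increasing_def outer_content_mono)
qed

text \<open>
  Caratheodory's criterion for open sets; only this direction is needed, since the other one is
  subadditivity.  Compact subsets of \<open>W \<inter> U\<close> and of the rest of \<open>W\<close> are exhausted one after the
  other: once \<open>K\<close> is chosen, the open set \<open>W - K\<close> covers \<open>A - U\<close>, and its compact subsets are
  disjoint from \<open>K\<close>.
\<close>

lemma outer_content_split:
  assumes \<nu>: "\<nu> \<in> contents I" and U: "open U"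
  shows "outer_content I \<nu> (A \<inter> U) + outer_content I \<nu> (A - U) \<le> outer_content I \<nu> A"
  unfolding outer_content_def[of I \<nu> A]
proof (rule INF_greatest)
  fix W assume "W \<in> {W. open W \<and> W \<subseteq> I \<and> A \<subseteq> W}"
  then have W: "open W" "W \<subseteq> I" "A \<subseteq> W" by auto
  have "outer_content I \<nu> (A \<inter> U) \<le> inner_content \<nu> (W \<inter> U)"
    unfolding outer_content_def using W U by (intro INF_lower) auto
  then have "outer_content I \<nu> (A \<inter> U) + outer_content I \<nu> (A - U)
      \<le> inner_content \<nu> (W \<inter> U) + outer_content I \<nu> (A - U)"
    by (rule add_right_mono)
  also have "\<dots> = (SUP K\<in>{K. compact K \<and> K \<subseteq> W \<inter> U}. \<nu> K + outer_content I \<nu> (A - U))"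
    unfolding inner_content_def
    by (subst ennreal_SUP_add_left) (auto intro: exI[of _ "{}"])
  also have "\<dots> \<le> inner_content \<nu> W"
  proof (rule SUP_least)
    fix K assume "K \<in> {K. compact K \<and> K \<subseteq> W \<inter> U}"
    then have K: "compact K" "K \<subseteq> W" "K \<subseteq> U" by auto
    have "outer_content I \<nu> (A - U) \<le> inner_content \<nu> (W - K)"
      unfolding outer_content_def using W K by (intro INF_lower) (auto simp: compact_imp_closed)
    then have "\<nu> K + outer_content I \<nu> (A - U) \<le> \<nu> K + inner_content \<nu> (W - K)"
      by (rule add_left_mono)
    also have "\<dots> = (SUP L\<in>{L. compact L \<and> L \<subseteq> W - K}. \<nu> K + \<nu> L)"
      unfolding inner_content_def
      by (subst ennreal_SUP_add_right) (auto intro: exI[of _ "{}"])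
    also have "\<dots> \<le> inner_content \<nu> W"
    proof (rule SUP_least)
      fix L assume "L \<in> {L. compact L \<and> L \<subseteq> W - K}"
      then have L: "compact L" "L \<subseteq> W - K" by auto
      have "K \<subseteq> I" "L \<subseteq> I" "K \<inter> L = {}" using L K W by auto
      then have "\<nu> K + \<nu> L = \<nu> (K \<union> L)"
        using \<nu> K L unfolding contents_def by auto
      also have "\<dots> \<le> inner_content \<nu> W"
        using K L by (intro content_le_inner) auto
      finally show "\<nu> K + \<nu> L \<le> inner_content \<nu> W" .
    qed
    finally show "\<nu> K + outer_content I \<nu> (A - U) \<le> inner_content \<nu> W" .
  qed
  finally show "outer_content I \<nu> (A \<inter> U) + outer_content I \<nu> (A - U) \<le> inner_content \<nu> W" .
qed

text \<open>
  The Borel measure on \<open>I\<close> that the content \<open>\<nu>\<close> induces.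
\<close>

definition content_measure :: "real set \<Rightarrow> (real set \<Rightarrow> ennreal) \<Rightarrow> real measure" where
  "content_measure I \<nu> = measure_of I (sets (restrict_space borel I)) (outer_content I \<nu>)"

lemma sets_restrict_borel_iff:
  "open I \<Longrightarrow> A \<in> sets (restrict_space borel I) \<longleftrightarrow> A \<in> sets borel \<and> A \<subseteq> (I::real set)"
  by (subst sets_restrict_space_iff) auto

lemma borel_subset_lambda_system:
  assumes I: "open I" and \<nu>: "\<nu> \<in> contents I"
  shows "sets (restrict_space borel I) \<subseteq> lambda_system I (Pow I) (outer_content I \<nu>)"
proof -
  let ?L = "lambda_system I (Pow I) (outer_content I \<nu>)"
  interpret P: sigma_algebra I "Pow I" by (rule sigma_algebra_Pow)
  have "measure_space I ?L (outer_content I \<nu>)"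
    by (intro P.caratheodory_lemma outer_measure_space_outer_content assms)
  then interpret L: sigma_algebra I ?L by (simp add: measure_space_def)
  have *: "U \<inter> I \<in> ?L" if "open U" for U
  proof -
    have "outer_content I \<nu> (A \<inter> (U \<inter> I)) + outer_content I \<nu> (A - (U \<inter> I)) = outer_content I \<nu> A"
      if "A \<subseteq> I" for A
    proof (rule antisym)
      show "outer_content I \<nu> (A \<inter> (U \<inter> I)) + outer_content I \<nu> (A - (U \<inter> I)) \<le> outer_content I \<nu> A"
        using I \<open>open U\<close> by (intro outer_content_split \<nu>) auto
      have "subadditive (Pow I) (outer_content I \<nu>)"
        using outer_measure_space_outer_content[OF I \<nu>]
        by (auto simp: outer_measure_space_def intro: P.countably_subadditive_subadditive)
      from subadditiveD[OF this, of "A \<inter> (U \<inter> I)" "A - (U \<inter> I)"] that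
      have "outer_content I \<nu> (A \<inter> (U \<inter> I) \<union> (A - (U \<inter> I)))
          \<le> outer_content I \<nu> (A \<inter> (U \<inter> I)) + outer_content I \<nu> (A - (U \<inter> I))" by blast
      then show "outer_content I \<nu> A \<le> outer_content I \<nu> (A \<inter> (U \<inter> I)) + outer_content I \<nu> (A - (U \<inter> I))"
        by (simp only: Int_Diff_Un)
    qed
    then show ?thesis by (auto simp: P.lambda_system_eq)
  qed
  have "sets (restrict_space borel I) = sigma_sets I ((\<inter>) I ` {S. open S})"
  proof -
    have "I \<in> sigma_sets UNIV {S. open S}" using I by (intro sigma_sets.Basic) simp
    then have "(\<inter>) I ` sigma_sets UNIV {S. open S} = sigma_sets I ((\<inter>) I ` {S. open S})"
      by (rule sigma_sets_Int) simp
    then show ?thesis by (simp add: sets_restrict_space borel_def)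
  qed
  also have "\<dots> \<subseteq> ?L"
  proof (rule L.sigma_sets_subset)
    show "(\<inter>) I ` {S. open S} \<subseteq> ?L" using * by (auto simp: Int_commute[of I])
  qed
  finally show ?thesis .
qed

lemma
  assumes I: "open I"
  shows sets_content_measure [simp]: "sets (content_measure I \<nu>) = sets (restrict_space borel I)"
    and space_content_measure [simp]: "space (content_measure I \<nu>) = I"
proof -
  have "sigma_algebra I (sets (restrict_space borel I))"
    using sets.sigma_algebra_axioms[of "restrict_space borel I"] by (simp add: space_restrict_space)
  then show "sets (content_measure I \<nu>) = sets (restrict_space borel I)"
    "space (content_measure I \<nu>) = I"
    by (simp_all add: content_measure_def sigma_algebra.sets_measure_of_eq
        sigma_algebra.space_measure_of_eq)
qed

lemma emeasure_content_measure:
  assumes I: "open I" and \<nu>: "\<nu> \<in> contents I" and A: "A \<in> sets borel" "A \<subseteq> I"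
  shows "emeasure (content_measure I \<nu>) A = outer_content I \<nu> A"
proof -
  interpret P: sigma_algebra I "Pow I" by (rule sigma_algebra_Pow)
  let ?L = "lambda_system I (Pow I) (outer_content I \<nu>)"
  let ?B = "sets (restrict_space borel I)"
  have "measure_space I ?L (outer_content I \<nu>)"
    by (intro P.caratheodory_lemma outer_measure_space_outer_content assms)
  then have "positive ?L (outer_content I \<nu>)" "countably_additive ?L (outer_content I \<nu>)"
    by (auto simp: measure_space_def)
  note L = this and sub = borel_subset_lambda_system[OF I \<nu>]
  have "positive ?B (outer_content I \<nu>)"
    using L(1) by (simp add: positive_def)
  moreover have "countably_additive ?B (outer_content I \<nu>)"
  proof (rule countably_additiveI)
    fix A :: "nat \<Rightarrow> real set"
    assume "range A \<subseteq> ?B" "disjoint_family A" "(\<Union>i. A i) \<in> ?B"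
    then show "(\<Sum>i. outer_content I \<nu> (A i)) = outer_content I \<nu> (\<Union>i. A i)"
      using L(2)[unfolded countably_additive_def, rule_format, of A] sub by (meson subsetD subset_trans)
  qed
  moreover have "sigma_algebra I ?B"
    using sets.sigma_algebra_axioms[of "restrict_space borel I"] by (simp add: space_restrict_space)
  moreover have "A \<in> ?B" using A sets_restrict_borel_iff[OF I] by simp
  ultimately show ?thesis
    unfolding content_measure_def by (metis emeasure_measure_of_sigma)
qed

text \<open>
  For infinite measures, outer regularity on Borel sets implies inner regularity.  If no point of
  \<open>A\<close> has infinite mass, then outer regularity at points covers \<open>A\<close> by open sets of finite mass,
  and the inner regularity of finite Borel measures on the line applies to the restrictions to
  finite unions of these sets.
\<close>

lemma inner_regular_if_outer_regular:
  fixes I :: "real set"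
  assumes I: "open I" and sets_M: "sets M = sets (restrict_space borel I)"
    and outer: "\<And>A. A \<in> sets M \<Longrightarrow>
      emeasure M A = (INF U\<in>{U. open U \<and> U \<subseteq> I \<and> A \<subseteq> U}. emeasure M U)"
    and A: "A \<in> sets M"
  shows "emeasure M A = (SUP K\<in>{K. compact K \<and> K \<subseteq> A}. emeasure M K)"
proof (rule antisym)
  have in_M: "B \<in> sets M \<longleftrightarrow> B \<in> sets borel \<and> B \<subseteq> I" for B
    using sets_M sets_restrict_borel_iff[OF I] by simp
  have space_M: "space M = I"
    using sets_eq_imp_space_eq[OF sets_M] by (simp add: space_restrict_space)
  show "(SUP K\<in>{K. compact K \<and> K \<subseteq> A}. emeasure M K) \<le> emeasure M A"
    using A by (intro SUP_least emeasure_mono) auto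
  show "emeasure M A \<le> (SUP K\<in>{K. compact K \<and> K \<subseteq> A}. emeasure M K)" (is "_ \<le> ?S")
  proof (cases "\<exists>x\<in>A. emeasure M {x} = \<infinity>")
    case True
    then obtain x where "x \<in> A" "emeasure M {x} = \<infinity>" by blast
    then show ?thesis by (intro SUP_upper2[of "{x}"]) auto
  next
    case False
    define \<U> where "\<U> = {U. open U \<and> U \<subseteq> I \<and> emeasure M U < \<infinity>}"
    have cover: "A \<subseteq> \<Union>\<U>"
    proof
      fix x assume x: "x \<in> A"
      then have "{x} \<in> sets M" using A in_M by auto
      from outer[OF this] False x have "(INF U\<in>{U. open U \<and> U \<subseteq> I \<and> {x} \<subseteq> U}. emeasure M U) < \<infinity>"
        by (auto simp: less_top)
      then show "x \<in> \<Union>\<U>" unfolding \<U>_def by (auto simp: INF_less_iff)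
    qed
    obtain \<V> where \<V>: "\<V> \<subseteq> \<U>" "countable \<V>" "\<Union>\<V> = \<Union>\<U>"
      using Lindelof[of \<U>] unfolding \<U>_def by blast
    have "countable (insert {} \<V>)" using \<V> by simp
    then obtain f :: "nat \<Rightarrow> real set" where f: "range f = insert {} \<V>"
      using range_from_nat_into[of "insert {} \<V>"] by blast
    define V where "V n = (\<Union>i<n. f i)" for n
    have f_fin: "open (f i) \<and> f i \<subseteq> I \<and> emeasure M (f i) < \<infinity>" for i
    proof -
      have "f i \<in> insert {} \<V>" using f by blast
      then show ?thesis using \<V>(1) unfolding \<U>_def by auto
    qed
    have V: "open (V n)" "V n \<subseteq> I" "V n \<in> sets M" for n
      using f_fin unfolding V_def in_M by (auto intro!: borel_open)
    have V_fin: "emeasure M (V n) < \<infinity>" for n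
    proof -
      have "emeasure M (V n) \<le> (\<Sum>i<n. emeasure M (f i))"
        unfolding V_def using f_fin in_M
        by (intro emeasure_subadditive_finite) (auto intro!: borel_open)
      also have "\<dots> < \<infinity>" using f_fin by auto
      finally show ?thesis .
    qed
    have "A = (\<Union>n. A \<inter> V n)"
    proof -
      have "(\<Union>n. V n) = \<Union>(range f)" unfolding V_def by (auto intro: lessI)
      also have "\<dots> = \<Union>\<U>" using f \<V> by simp
      finally show ?thesis using cover by auto
    qed
    moreover have "incseq (\<lambda>n. A \<inter> V n)"
      unfolding V_def by (intro monoI) (auto intro: less_le_trans)
    moreover have "range (\<lambda>n. A \<inter> V n) \<subseteq> sets M" using A V by blast
    ultimately have "emeasure M A = (SUP n. emeasure M (A \<inter> V n))"
      using SUP_emeasure_incseq[of "\<lambda>n. A \<inter> V n" M] by simp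
    also have "\<dots> \<le> ?S"
    proof (rule SUP_least)
      fix n
      define N where "N = distr (density M (indicator (V n))) borel (\<lambda>x. x)"
      have meas: "(\<lambda>x. x) \<in> measurable (density M (indicator (V n))) borel"
      proof (rule measurableI)
        fix B :: "real set" assume "B \<in> sets borel"
        then show "(\<lambda>x. x) -` B \<inter> space (density M (indicator (V n))) \<in> sets (density M (indicator (V n)))"
          using I by (auto simp: space_M in_M)
      qed simp
      have N: "emeasure N B = emeasure M (B \<inter> V n)" if B: "B \<in> sets borel" for B
      proof -
        have BI: "B \<inter> I \<in> sets M" using B I by (auto simp: in_M)
        have "emeasure N B = emeasure (density M (indicator (V n))) (B \<inter> I)"
          using emeasure_distr[OF meas B] by (simp add: N_def space_M)
        also have "\<dots> = (\<integral>\<^sup>+x. indicator (V n) x * indicator (B \<inter> I) x \<partial>M)"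
          using V BI by (intro emeasure_density) auto
        also have "\<dots> = (\<integral>\<^sup>+x. indicator (B \<inter> V n) x \<partial>M)"
          using V(2)[of n] by (intro nn_integral_cong) (auto split: split_indicator)
        also have "\<dots> = emeasure M (B \<inter> V n)"
          using B V by (intro nn_integral_indicator) (auto simp: in_M)
        finally show ?thesis .
      qed
      have AV: "A \<inter> V n \<in> sets borel" using A V in_M by blast
      moreover have "emeasure N (space N) \<noteq> \<infinity>"
        using N[of UNIV] V_fin[of n] by (simp add: N_def)
      ultimately have "emeasure N (A \<inter> V n) = (SUP K\<in>{K. K \<subseteq> A \<inter> V n \<and> compact K}. emeasure N K)"
        by (intro inner_regular) (auto simp: N_def)
      also have "\<dots> \<le> ?S"
      proof (rule SUP_least)
        fix K assume "K \<in> {K. K \<subseteq> A \<inter> V n \<and> compact K}"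
        then have K: "K \<subseteq> A \<inter> V n" "compact K" by auto
        then have "emeasure N K = emeasure M (K \<inter> V n)" by (intro N borel_compact)
        also have "K \<inter> V n = K" using K by auto
        also have "emeasure M K \<le> ?S" using K by (intro SUP_upper) auto
        finally show "emeasure N K \<le> ?S" .
      qed
      finally show "emeasure M (A \<inter> V n) \<le> ?S"
        using N[OF AV] by (simp add: Int_assoc)
    qed
    finally show ?thesis .
  qed
qed

lemma content_measure_regular:
  assumes I: "open I" and \<nu>: "\<nu> \<in> contents I"
  shows "content_measure I \<nu> \<in> regular_measures I"
proof -
  let ?M = "content_measure I \<nu>"
  have eq: "emeasure ?M A = outer_content I \<nu> A" if "A \<in> sets ?M" for A
    using that I by (intro emeasure_content_measure \<nu>) (auto simp: sets_restrict_borel_iff)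
  have outer: "emeasure ?M A = (INF U\<in>{U. open U \<and> U \<subseteq> I \<and> A \<subseteq> U}. emeasure ?M U)"
    if A: "A \<in> sets ?M" for A
  proof -
    have "(INF U\<in>{U. open U \<and> U \<subseteq> I \<and> A \<subseteq> U}. emeasure ?M U)
        = (INF U\<in>{U. open U \<and> U \<subseteq> I \<and> A \<subseteq> U}. inner_content \<nu> U)"
    proof (intro INF_cong refl)
      fix U assume "U \<in> {U. open U \<and> U \<subseteq> I \<and> A \<subseteq> U}"
      then show "emeasure ?M U = inner_content \<nu> U"
        using I \<nu> by (simp add: emeasure_content_measure outer_content_open)
    qed
    then show ?thesis using eq[OF A] by (simp add: outer_content_def)
  qed
  show ?thesis
    unfolding regular_measures_def
  proof (intro CollectI conjI ballI)
    fix A assume A: "A \<in> sets ?M"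
    show "emeasure ?M A = (SUP K\<in>{K. compact K \<and> K \<subseteq> A}. emeasure ?M K)"
      by (rule inner_regular_if_outer_regular[OF I _ outer A]) (simp_all add: I)
  qed (use I in simp, rule outer)
qed

lemma
  assumes "open I" "\<nu> \<in> contents I"
  shows emeasure_content_measure_open:
    "open U \<Longrightarrow> U \<subseteq> I \<Longrightarrow> emeasure (content_measure I \<nu>) U = inner_content \<nu> U"
  and emeasure_content_measure_compact:
    "compact K \<Longrightarrow> K \<subseteq> I \<Longrightarrow> emeasure (content_measure I \<nu>) K = outer_content I \<nu> K"
  using assms by (simp_all add: emeasure_content_measure outer_content_open borel_compact)

section \<open>Contents form a compact space that maps onto the regular measures\<close>

lemma compact_contents: "compact (contents I)"
proof -
  have "compact_space (euclidean :: ennreal topology)"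
    by (simp add: compact_space_def compact_UNIV)
  then have "compact_space (product_topology (\<lambda>_::real set. euclidean :: ennreal topology) UNIV)"
    unfolding compact_space_product_topology by blast
  then have univ: "compact (UNIV :: (real set \<Rightarrow> ennreal) set)"
    by (simp add: euclidean_product_topology compact_space_def)
  have "closed (contents I)"
    unfolding contents_def
    by (intro closed_Collect_conj closed_Collect_all closed_Collect_imp closed_Collect_eq
        closed_Collect_le continuous_on_add_ennreal continuous_on_product_coordinates
        continuous_on_const open_Collect_const)
  then show ?thesis
    using univ by (metis compact_Int_closed inf_top_left)
qed

lemma open_superset_Icc_rational:
  assumes "open U" "{x..y} \<subseteq> U" "x \<le> (y::real)"
  obtains a b where "a \<in> \<rat>" "b \<in> \<rat>" "a < x" "y < b" "{a..b} \<subseteq> U"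
proof -
  have "x \<in> U" "y \<in> U" using assms by auto
  then obtain d e where de: "d > 0" "ball x d \<subseteq> U" "e > 0" "ball y e \<subseteq> U"
    using \<open>open U\<close> open_contains_ball by metis
  obtain a where a: "a \<in> \<rat>" "x - d < a" "a < x" using Rats_dense_in_real[of "x - d" x] de by auto
  obtain b where b: "b \<in> \<rat>" "y < b" "b < y + e" using Rats_dense_in_real[of y "y + e"] de by auto
  have "{a..b} \<subseteq> U"
  proof
    fix z assume z: "z \<in> {a..b}"
    consider "z < x" | "z \<in> {x..y}" | "y < z" by force
    then show "z \<in> U"
    proof cases
      case 1
      then have "z \<in> ball x d" using z a by (auto simp: dist_real_def)
      then show ?thesis using de by auto
    next
      case 3
      then have "z \<in> ball y e" using z b by (auto simp: dist_real_def)
      then show ?thesis using de by auto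
    qed (use assms in auto)
  qed
  then show ?thesis using that a b by blast
qed

context
  fixes I :: "real set"
  assumes I: "open I"
begin

lemma regular_measures_sets:
  "m \<in> regular_measures I \<Longrightarrow> A \<in> sets m \<longleftrightarrow> A \<in> sets borel \<and> A \<subseteq> I"
  unfolding regular_measures_def using sets_restrict_borel_iff[OF I] by auto

lemma regular_measures_space: "m \<in> regular_measures I \<Longrightarrow> space m = I"
  unfolding regular_measures_def
  by (auto dest!: sets_eq_imp_space_eq simp: space_restrict_space)

lemma regular_measures_outer:
  "m \<in> regular_measures I \<Longrightarrow> A \<in> sets borel \<Longrightarrow> A \<subseteq> I \<Longrightarrow>
    emeasure m A = (INF U\<in>{U. open U \<and> U \<subseteq> I \<and> A \<subseteq> U}. emeasure m U)"
  using regular_measures_sets[of m A] unfolding regular_measures_def by blast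

lemma regular_measures_inner:
  "m \<in> regular_measures I \<Longrightarrow> A \<in> sets borel \<Longrightarrow> A \<subseteq> I \<Longrightarrow>
    emeasure m A = (SUP K\<in>{K. compact K \<and> K \<subseteq> A}. emeasure m K)"
  using regular_measures_sets[of m A] unfolding regular_measures_def by blast

lemma regular_measures_mono:
  "m \<in> regular_measures I \<Longrightarrow> A \<subseteq> B \<Longrightarrow> B \<in> sets borel \<Longrightarrow> B \<subseteq> I \<Longrightarrow> emeasure m A \<le> emeasure m B"
  by (intro emeasure_mono) (auto simp: regular_measures_sets)

lemma emeasure_in_contents:
  assumes m: "m \<in> regular_measures I"
  shows "emeasure m \<in> contents I"
proof -
  have "K \<in> sets m" if "compact K" "K \<subseteq> I" for K
    using that by (simp add: regular_measures_sets[OF m] borel_compact)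
  then show ?thesis
    unfolding contents_def
    by (auto intro!: emeasure_mono emeasure_subadditive plus_emeasure[symmetric])
qed

lemma content_measure_emeasure:
  assumes m: "m \<in> regular_measures I"
  shows "content_measure I (emeasure m) = m"
proof (rule measure_eqI)
  show "sets (content_measure I (emeasure m)) = sets m"
    using m I unfolding regular_measures_def by simp
  fix A assume "A \<in> sets (content_measure I (emeasure m))"
  then have A: "A \<in> sets borel" "A \<subseteq> I" using I by (auto simp: sets_restrict_borel_iff)
  have "emeasure (content_measure I (emeasure m)) A = outer_content I (emeasure m) A"
    by (intro emeasure_content_measure I emeasure_in_contents m A)
  also have "\<dots> = (INF U\<in>{U. open U \<and> U \<subseteq> I \<and> A \<subseteq> U}. emeasure m U)"
    unfolding outer_content_def inner_content_def
    by (intro INF_cong refl regular_measures_inner[OF m, symmetric]) auto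
  also have "\<dots> = emeasure m A" by (rule regular_measures_outer[OF m A, symmetric])
  finally show "emeasure (content_measure I (emeasure m)) A = emeasure m A" .
qed

text \<open>
  The next two lemmas are the semicontinuity properties on the space of contents, where masses
  of fixed compact sets are coordinate functions.
\<close>

lemma openin_content_measure_open:
  assumes U: "open U" "U \<subseteq> I"
  shows "openin (top_of_set (contents I)) {\<nu> \<in> contents I. c < emeasure (content_measure I \<nu>) U}"
proof -
  have "{\<nu> \<in> contents I. c < emeasure (content_measure I \<nu>) U}
      = contents I \<inter> (\<Union>K\<in>{K. compact K \<and> K \<subseteq> U}. {\<nu>. c < \<nu> K})"
    using I U by (auto simp: emeasure_content_measure_open inner_content_def less_SUP_iff)
  moreover have "open (\<Union>K\<in>{K. compact K \<and> K \<subseteq> U}. {\<nu>. c < \<nu> K})"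
    by (intro open_UN ballI open_Collect_less continuous_on_const continuous_on_product_coordinates)
  ultimately show ?thesis by (simp add: openin_open_Int)
qed

lemma openin_content_measure_compact:
  assumes K: "compact K" "K \<subseteq> I"
  shows "openin (top_of_set (contents I)) {\<nu> \<in> contents I. emeasure (content_measure I \<nu>) K < c}"
proof -
  let ?\<L> = "{L. compact L \<and> L \<subseteq> I \<and> K \<subseteq> interior L}"
  have "outer_content I \<nu> K < c \<longleftrightarrow> (\<exists>L\<in>?\<L>. \<nu> L < c)" if \<nu>: "\<nu> \<in> contents I" for \<nu>
  proof
    assume "outer_content I \<nu> K < c"
    then obtain U where U: "open U" "U \<subseteq> I" "K \<subseteq> U" "inner_content \<nu> U < c"
      unfolding outer_content_less_iff by blast
    obtain L where L: "compact L" "K \<subseteq> interior L" "L \<subseteq> U"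
      using compact_nhd_within_open[OF K(1) U(1) U(3)] .
    then show "\<exists>L\<in>?\<L>. \<nu> L < c"
      using U content_le_inner[OF L(1,3), of \<nu>] by (intro bexI[of _ L]) auto
  next
    assume "\<exists>L\<in>?\<L>. \<nu> L < c"
    then obtain L where L: "compact L" "L \<subseteq> I" "K \<subseteq> interior L" "\<nu> L < c" by blast
    have "inner_content \<nu> (interior L) \<le> \<nu> L"
      by (rule inner_le_content[OF \<nu> L(1,2) interior_subset])
    then have "inner_content \<nu> (interior L) < c" using L by order
    then show "outer_content I \<nu> K < c"
      unfolding outer_content_less_iff using L interior_subset[of L]
      by (intro exI[of _ "interior L"]) auto
  qed
  then have "{\<nu> \<in> contents I. emeasure (content_measure I \<nu>) K < c}
      = contents I \<inter> (\<Union>L\<in>?\<L>. {\<nu>. \<nu> L < c})"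
    using I K by (auto simp: emeasure_content_measure_compact)
  moreover have "open (\<Union>L\<in>?\<L>. {\<nu>. \<nu> L < c})"
    by (intro open_UN ballI open_Collect_less continuous_on_const continuous_on_product_coordinates)
  ultimately show ?thesis by (simp add: openin_open_Int)
qed

context
  assumes interval: "is_interval I"
begin

lemma Icc_subset_interval: "a \<in> I \<Longrightarrow> b \<in> I \<Longrightarrow> {a..b} \<subseteq> I"
  using interval mem_is_interval_1_I[of I a b] by auto

lemma continuous_map_content_measure:
  "continuous_map (top_of_set (contents I)) (vtheta I) (content_measure I)"
  unfolding vtheta_def
proof (rule continuous_on_generated_topo)
  fix S
  assume "S \<in> insert (regular_measures I)
       ({{m \<in> regular_measures I. c < emeasure m {a<..<b}} | a b c.
            a \<in> I \<inter> \<rat> \<and> b \<in> I \<inter> \<rat> \<and> a < b} \<union>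
        {{m \<in> regular_measures I. emeasure m {a..b} < c} | a b c.
            a \<in> I \<inter> \<rat> \<and> b \<in> I \<inter> \<rat> \<and> a \<le> b})"
  then consider "S = regular_measures I"
    | a b c where "S = {m \<in> regular_measures I. c < emeasure m {a<..<b}}" "a \<in> I" "b \<in> I"
    | a b c where "S = {m \<in> regular_measures I. emeasure m {a..b} < c}" "a \<in> I" "b \<in> I"
    by blast
  then show "openin (top_of_set (contents I))
      (content_measure I -` S \<inter> topspace (top_of_set (contents I)))"
  proof cases
    case 1
    then have "content_measure I -` S \<inter> topspace (top_of_set (contents I)) = contents I"
      using content_measure_regular[OF I] by auto
    then show ?thesis by simp
  next
    case 2
    then have "content_measure I -` S \<inter> topspace (top_of_set (contents I))
        = {\<nu> \<in> contents I. c < emeasure (content_measure I \<nu>) {a<..<b}}"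
      using content_measure_regular[OF I] by auto
    moreover have "{a<..<b} \<subseteq> I" using Icc_subset_interval[of a b] 2 by auto
    ultimately show ?thesis by (simp add: openin_content_measure_open)
  next
    case 3
    then have "content_measure I -` S \<inter> topspace (top_of_set (contents I))
        = {\<nu> \<in> contents I. emeasure (content_measure I \<nu>) {a..b} < c}"
      using content_measure_regular[OF I] by auto
    then show ?thesis using 3 by (simp add: openin_content_measure_compact Icc_subset_interval)
  qed
qed (use content_measure_regular[OF I] in auto)

lemma content_measure_image: "content_measure I ` contents I = regular_measures I"
  using content_measure_regular[OF I] emeasure_in_contents content_measure_emeasure
  by (auto intro!: image_eqI[of _ _ "emeasure _"])

lemma compact_space_vtheta: "compact_space (vtheta I)"
proof -
  have "compact_space (top_of_set (contents I))"
    using compact_contents by (simp add: compact_space_subtopology)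
  then show ?thesis
    using image_compactin[OF _ continuous_map_content_measure, of "contents I"]
    by (simp add: compact_space_def content_measure_image)
qed

section \<open>The Hausdorff property and semicontinuity\<close>

text \<open>
  Comparison passes from rational intervals to compact intervals by outer regularity, to open
  intervals by inner regularity, to open sets through their countably many components, and to
  Borel sets by outer regularity.
\<close>

lemma regular_measures_le:
  assumes m: "m \<in> regular_measures I" and m': "m' \<in> regular_measures I"
    and le: "\<And>a b. a \<in> I \<inter> \<rat> \<Longrightarrow> b \<in> I \<inter> \<rat> \<Longrightarrow> a < b \<Longrightarrow> emeasure m {a<..<b} \<le> emeasure m' {a..b}"
    and A: "A \<in> sets borel" "A \<subseteq> I"
  shows "emeasure m A \<le> emeasure m' A"
proof -
  have Icc: "emeasure m {x..y} \<le> emeasure m' {x..y}" if xy: "x \<le> y" "{x..y} \<subseteq> I" for x y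
    unfolding regular_measures_outer[OF m' _ xy(2), simplified]
  proof (rule INF_greatest)
    fix U assume "U \<in> {U. open U \<and> U \<subseteq> I \<and> {x..y} \<subseteq> U}"
    then have U: "open U" "U \<subseteq> I" "{x..y} \<subseteq> U" by auto
    obtain a b where ab: "a \<in> \<rat>" "b \<in> \<rat>" "a < x" "y < b" "{a..b} \<subseteq> U"
      using open_superset_Icc_rational[OF U(1,3) xy(1)] .
    then have abI: "{a..b} \<subseteq> I" "{a<..<b} \<subseteq> {a..b}" "a < b" using U xy by auto
    have "emeasure m {x..y} \<le> emeasure m {a<..<b}"
      using ab abI by (intro regular_measures_mono[OF m]) auto
    also have "\<dots> \<le> emeasure m' {a..b}"
      using ab abI by (intro le) auto
    also have "\<dots> \<le> emeasure m' U"
      using ab U by (intro regular_measures_mono[OF m'] borel_open)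
    finally show "emeasure m {x..y} \<le> emeasure m' U" .
  qed
  have conn: "emeasure m C \<le> emeasure m' C" if C: "open C" "C \<subseteq> I" "connected C" for C
    unfolding regular_measures_inner[OF m borel_open[OF C(1)] C(2)]
  proof (rule SUP_least)
    fix K assume "K \<in> {K. compact K \<and> K \<subseteq> C}"
    then have K: "compact K" "K \<subseteq> C" by auto
    show "emeasure m K \<le> emeasure m' C"
    proof (cases "K = {}")
      case False
      obtain x y where xy: "x \<in> K" "\<And>z. z \<in> K \<Longrightarrow> x \<le> z" "y \<in> K" "\<And>z. z \<in> K \<Longrightarrow> z \<le> y"
        using compact_attains_inf[OF K(1) False] compact_attains_sup[OF K(1) False] by blast
      have sub: "{x..y} \<subseteq> C" using xy K by (intro connected_contains_Icc[OF C(3)]) auto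
      have "emeasure m K \<le> emeasure m {x..y}"
        using xy sub C by (intro regular_measures_mono[OF m]) auto
      also have "\<dots> \<le> emeasure m' {x..y}" using xy sub C by (intro Icc) auto
      also have "\<dots> \<le> emeasure m' C" using sub C by (intro regular_measures_mono[OF m']) auto
      finally show ?thesis .
    qed simp
  qed
  have "emeasure m U \<le> emeasure m' U" if U: "open U" "U \<subseteq> I" for U
  proof -
    have comp: "open C \<and> C \<subseteq> I \<and> connected C" if "C \<in> components U" for C
      using that U in_components_subset[OF that] open_components in_components_connected by blast
    have pw: "disjoint_family_on (\<lambda>C. C) (components U)"
      using pairwise_disjoint_components[of U] by (auto simp: disjoint_family_on_def pairwise_def)
    have cnt: "countable (components U)"
      using comp pairwise_disjoint_components[of U]
      by (intro countable_disjoint_open_subsets) (auto simp: disjnt_def pairwise_def)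
    have sum: "emeasure \<mu> U = (\<integral>\<^sup>+C. emeasure \<mu> C \<partial>count_space (components U))"
      if "\<mu> \<in> regular_measures I" for \<mu>
      using emeasure_UN_countable[OF _ cnt pw, of \<mu>] comp
      by (simp add: regular_measures_sets[OF that])
    show ?thesis
      unfolding sum[OF m] sum[OF m'] using comp by (intro nn_integral_mono) (auto intro!: conn)
  qed
  then show ?thesis
    unfolding regular_measures_outer[OF m A] regular_measures_outer[OF m' A]
    by (intro INF_mono) auto
qed

text \<open>
  The strict inequality between an open interval and its closure is what a pair of subbasic open
  sets can separate.
\<close>

lemma regular_measures_distinct:
  assumes m: "m \<in> regular_measures I" and m': "m' \<in> regular_measures I" and "m \<noteq> m'"
  obtains a b where "a \<in> I \<inter> \<rat>" "b \<in> I \<inter> \<rat>" "a < b"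
    "emeasure m' {a..b} < emeasure m {a<..<b} \<or> emeasure m {a..b} < emeasure m' {a<..<b}"
proof (rule ccontr)
  assume no: "\<not> thesis"
  note witness = that
  have *: "emeasure m {a<..<b} \<le> emeasure m' {a..b} \<and> emeasure m' {a<..<b} \<le> emeasure m {a..b}"
    if "a \<in> I \<inter> \<rat>" "b \<in> I \<inter> \<rat>" "a < b" for a b
    using that no witness by (meson not_le)
  have "m = m'"
  proof (rule measure_eqI)
    show "sets m = sets m'" using m m' by (simp add: regular_measures_def)
    fix A assume "A \<in> sets m"
    then have "A \<in> sets borel" "A \<subseteq> I" by (auto simp: regular_measures_sets[OF m])
    then show "emeasure m A = emeasure m' A"
      using * by (intro antisym regular_measures_le m m') auto
  qed
  then show False using \<open>m \<noteq> m'\<close> by simp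
qed

lemma Hausdorff_space_vtheta: "Hausdorff_space (vtheta I)"
proof -
  have sep: "\<exists>U V. openin (vtheta I) U \<and> openin (vtheta I) V \<and> m \<in> U \<and> m' \<in> V \<and> disjnt U V"
    if m: "m \<in> regular_measures I" and m': "m' \<in> regular_measures I"
      and ab: "a \<in> I \<inter> \<rat>" "b \<in> I \<inter> \<rat>" "a < b" and less: "emeasure m' {a..b} < emeasure m {a<..<b}"
    for m m' a b
  proof -
    obtain c where c: "emeasure m' {a..b} < c" "c < emeasure m {a<..<b}"
      using dense[OF less] by blast
    let ?U = "{m \<in> regular_measures I. c < emeasure m {a<..<b}}"
    let ?V = "{m \<in> regular_measures I. emeasure m {a..b} < c}"
    have "disjnt ?U ?V"
    proof -
      have "\<not> (c < emeasure \<mu> {a<..<b} \<and> emeasure \<mu> {a..b} < c)"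
        if "\<mu> \<in> regular_measures I" for \<mu>
      proof -
        have "emeasure \<mu> {a<..<b} \<le> emeasure \<mu> {a..b}"
          using ab Icc_subset_interval[of a b] by (intro regular_measures_mono[OF that]) auto
        then show ?thesis using less_le_trans less_asym by blast
      qed
      then show ?thesis unfolding disjnt_iff by blast
    qed
    moreover have "openin (vtheta I) ?U" "openin (vtheta I) ?V"
      using vtheta_semicont[OF ab(1,2)] ab(3) by (auto simp: lower_semicont_def upper_semicont_def)
    ultimately show ?thesis using c m m' by blast
  qed
  show ?thesis
    unfolding Hausdorff_space_def topspace_vtheta
  proof (intro allI impI, elim conjE)
    fix m m' assume m: "m \<in> regular_measures I" "m' \<in> regular_measures I" "m \<noteq> m'"
    from regular_measures_distinct[OF m]
    obtain a b where ab: "a \<in> I \<inter> \<rat>" "b \<in> I \<inter> \<rat>" "a < b"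
      and "emeasure m' {a..b} < emeasure m {a<..<b} \<or> emeasure m {a..b} < emeasure m' {a<..<b}" .
    from this(4) show "\<exists>U V. openin (vtheta I) U \<and> openin (vtheta I) V \<and> m \<in> U \<and> m' \<in> V \<and> disjnt U V"
    proof
      assume "emeasure m {a..b} < emeasure m' {a<..<b}"
      from sep[OF m(2,1) ab this] show ?thesis using disjnt_sym by blast
    qed (rule sep[OF m(1,2) ab])
  qed
qed

text \<open>
  The continuous surjection is closed, as it maps a compact space to a Hausdorff space.  So a set of
  measures is open if its preimage in the space of contents is open.
\<close>

lemma quotient_map_content_measure:
  "quotient_map (top_of_set (contents I)) (vtheta I) (content_measure I)"
  using compact_contents content_measure_image
  by (intro continuous_imp_quotient_map continuous_map_content_measure Hausdorff_space_vtheta)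
    (auto simp: compact_space_subtopology)

lemma lower_semicont_emeasure_open:
  assumes "open U" "U \<subseteq> I"
  shows "lower_semicont (vtheta I) (\<lambda>m. emeasure m U)"
  unfolding lower_semicont_def
proof
  fix c
  have "{\<nu> \<in> contents I. content_measure I \<nu> \<in> {m \<in> regular_measures I. c < emeasure m U}}
      = {\<nu> \<in> contents I. c < emeasure (content_measure I \<nu>) U}"
    using content_measure_regular[OF I] by auto
  then show "openin (vtheta I) {m \<in> topspace (vtheta I). c < emeasure m U}"
    using quotient_map_content_measure[unfolded quotient_map_def, THEN conjunct2, rule_format,
        of "{m \<in> regular_measures I. c < emeasure m U}"] openin_content_measure_open[OF assms, of c]
    by auto
qed

lemma upper_semicont_emeasure_compact:
  assumes "compact K" "K \<subseteq> I"
  shows "upper_semicont (vtheta I) (\<lambda>m. emeasure m K)"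
  unfolding upper_semicont_def
proof
  fix c
  have "{\<nu> \<in> contents I. content_measure I \<nu> \<in> {m \<in> regular_measures I. emeasure m K < c}}
      = {\<nu> \<in> contents I. emeasure (content_measure I \<nu>) K < c}"
    using content_measure_regular[OF I] by auto
  then show "openin (vtheta I) {m \<in> topspace (vtheta I). emeasure m K < c}"
    using quotient_map_content_measure[unfolded quotient_map_def, THEN conjunct2, rule_format,
        of "{m \<in> regular_measures I. emeasure m K < c}"] openin_content_measure_compact[OF assms, of c]
    by auto
qed

end

end

section \<open>Metrizability\<close>

lemma metrizable_space_if_countable_separating:
  fixes F :: "('a \<Rightarrow> real) set"
  assumes X: "compact_space X" "Hausdorff_space X" and F: "countable F"
    and cont: "\<And>f. f \<in> F \<Longrightarrow> continuous_map X euclideanreal f"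
    and sep: "\<And>x y. x \<in> topspace X \<Longrightarrow> y \<in> topspace X \<Longrightarrow> x \<noteq> y \<Longrightarrow> \<exists>f\<in>F. f x \<noteq> f y"
  shows "metrizable_space X"
proof -
  define Y where "Y = product_topology (\<lambda>_. euclideanreal) F"
  define g where "g x = (\<lambda>f\<in>F. f x)" for x
  have Y: "metrizable_space Y"
    unfolding Y_def
  proof (rule metrizable_topology_D)
    show "countable {f \<in> F. \<nexists>a. topspace euclideanreal \<subseteq> {a}}"
      using F by (rule countable_subset[rotated]) auto
    show "topspace (product_topology (\<lambda>_. euclideanreal) F) \<noteq> {}"
      by (simp add: PiE_eq_empty_iff)
  qed (rule metrizable_space_euclidean)
  have "continuous_map X Y g"
    unfolding Y_def g_def using cont by (intro continuous_map_componentwise[THEN iffD2]) auto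
  moreover have "inj_on g (topspace X)"
  proof (rule inj_onI, rule ccontr)
    fix x y assume xy: "x \<in> topspace X" "y \<in> topspace X" "g x = g y" "x \<noteq> y"
    then obtain f where "f \<in> F" "f x \<noteq> f y" using sep by blast
    then show False using fun_cong[OF xy(3), of f] by (simp add: g_def)
  qed
  ultimately have "embedding_map X Y g"
    using X(1) metrizable_imp_Hausdorff_space[OF Y] by (intro continuous_imp_embedding_map)
  from embedding_map_imp_homeomorphic_space[OF this] show ?thesis
    using homeomorphic_metrizable_space metrizable_space_subtopology[OF Y] by blast
qed

context
  fixes I :: "real set"
  assumes I: "open I" and interval: "is_interval I"
begin

lemma normal_space_vtheta: "normal_space (vtheta I)"
  using compact_space_vtheta[OF I interval] Hausdorff_space_vtheta[OF I interval]
  by (simp add: compact_Hausdorff_or_regular_imp_normal_space)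

text \<open>
  Two distinct measures are separated by disjoint closed sets \<open>{m. m (a, b) \<le> c}\<close> and
  \<open>{m. d \<le> m [a', b']}\<close> with \<open>[a', b'] \<subseteq> (a, b)\<close> and \<open>c < d\<close>, where all parameters range over countable
  dense sets.  One Urysohn function for each such pair suffices.
\<close>

lemma metrizable_space_vtheta: "metrizable_space (vtheta I)"
proof -
  \<comment> \<open>countably many thresholds, dense in \<open>[0, \<infinity>]\<close>\<close>
  obtain D :: "ennreal set" where D: "countable D" "\<And>X. open X \<Longrightarrow> X \<noteq> {} \<Longrightarrow> \<exists>d\<in>D. d \<in> X"
    using countable_dense_setE by blast
  have between: "\<exists>d\<in>D. x < d \<and> d < y" if "x < y" for x y
    using D(2)[of "{x<..<y}"] dense[OF that] by auto
  define low where "low = (\<lambda>(a, b, c). {m \<in> regular_measures I. emeasure m {a<..<b} \<le> c})"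
  define high where "high = (\<lambda>(a, b, c). {m \<in> regular_measures I. c \<le> emeasure m {a..b}})"
  define T where "T = {(s, t) \<in> (\<rat> \<times> \<rat> \<times> D) \<times> (\<rat> \<times> \<rat> \<times> D).
    closedin (vtheta I) (low s) \<and> closedin (vtheta I) (high t) \<and> disjnt (low s) (high t)}"
  have "countable T"
  proof (rule countable_subset)
    show "T \<subseteq> (\<rat> \<times> \<rat> \<times> D) \<times> (\<rat> \<times> \<rat> \<times> D)" unfolding T_def by blast
    show "countable ((\<rat> \<times> \<rat> \<times> D) \<times> (\<rat> \<times> \<rat> \<times> D) :: ((real \<times> real \<times> ennreal) \<times> (real \<times> real \<times> ennreal)) set)"
      using D(1) by (intro countable_SIGMA countable_rat)
  qed
  have "\<exists>f. continuous_map (vtheta I) euclideanreal f \<and> f ` low s \<subseteq> {0} \<and> f ` high t \<subseteq> {1}"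
    if "(s, t) \<in> T" for s t
  proof -
    have *: "closedin (vtheta I) (low s)" "closedin (vtheta I) (high t)" "disjnt (low s) (high t)"
      using that by (auto simp: T_def)
    show ?thesis using Urysohn_lemma_alt[OF normal_space_vtheta *, of 0 1] by metis
  qed
  then obtain f where f: "\<And>s t. (s, t) \<in> T \<Longrightarrow> continuous_map (vtheta I) euclideanreal (f s t)"
    "\<And>s t. (s, t) \<in> T \<Longrightarrow> f s t ` low s \<subseteq> {0} \<and> f s t ` high t \<subseteq> {1}"
    by metis
  have sep: "\<exists>s t. (s, t) \<in> T \<and> f s t m \<noteq> f s t m'"
    if m: "m \<in> regular_measures I" and m': "m' \<in> regular_measures I"
      and ab: "a \<in> I \<inter> \<rat>" "b \<in> I \<inter> \<rat>" "a < b" and less: "emeasure m' {a..b} < emeasure m {a<..<b}"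
    for m m' a b
  proof -
    have abI: "{a..b} \<subseteq> I" "{a<..<b} \<subseteq> {a..b}"
      using Icc_subset_interval[OF I interval, of a b] ab by auto
    then have abI': "{a<..<b} \<subseteq> I" by blast
    obtain c where c: "c \<in> D" "emeasure m' {a..b} < c" "c < emeasure m {a<..<b}"
      using between[OF less] by blast
    obtain d where d: "d \<in> D" "c < d" "d < emeasure m {a<..<b}"
      using between[OF c(3)] by blast
    have "d < (SUP K\<in>{K. compact K \<and> K \<subseteq> {a<..<b}}. emeasure m K)"
      using d(3) unfolding regular_measures_inner[OF I m _ abI', simplified] .
    then obtain K where K: "compact K" "K \<subseteq> {a<..<b}" "d < emeasure m K"
      unfolding less_SUP_iff by blast
    then have "K \<noteq> {}" by auto
    obtain x y where xy: "x \<in> K" "\<And>z. z \<in> K \<Longrightarrow> x \<le> z" "y \<in> K" "\<And>z. z \<in> K \<Longrightarrow> z \<le> y"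
      using compact_attains_inf[OF K(1) \<open>K \<noteq> {}\<close>] compact_attains_sup[OF K(1) \<open>K \<noteq> {}\<close>] by blast
    have "x \<in> {a<..<b}" "y \<in> {a<..<b}" using xy K(2) by blast+
    then have "{x..y} \<subseteq> {a<..<b}" by auto
    have "x \<le> y" using xy by blast
    obtain a' b' where ab': "a' \<in> \<rat>" "b' \<in> \<rat>" "a' < x" "y < b'" "{a'..b'} \<subseteq> {a<..<b}"
      using open_superset_Icc_rational[OF open_greaterThanLessThan \<open>{x..y} \<subseteq> {a<..<b}\<close> \<open>x \<le> y\<close>] .
    then have lt: "a' < b'" using \<open>x \<le> y\<close> by simp
    then have ab'I: "a' \<in> I" "b' \<in> I" using ab'(5) abI' by force+
    have sub: "{a'..b'} \<subseteq> I" using ab'(5) abI' by (rule subset_trans)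
    have "K \<subseteq> {a'..b'}"
    proof
      fix z assume "z \<in> K"
      then show "z \<in> {a'..b'}" using xy(2,4)[of z] ab'(3,4) by simp
    qed
    then have "emeasure m K \<le> emeasure m {a'..b'}"
      using sub by (intro regular_measures_mono[OF I m]) auto
    then have high: "m \<in> high (a', b', d)" using K(3) m by (auto simp: high_def)
    have "emeasure m' {a<..<b} \<le> emeasure m' {a..b}"
      using abI by (intro regular_measures_mono[OF I m']) auto
    then have low: "m' \<in> low (a, b, c)" using c(2) m' by (auto simp: low_def)
    have "closedin (vtheta I) (low (a, b, c))"
    proof -
      have "low (a, b, c) = topspace (vtheta I) - {m \<in> topspace (vtheta I). c < emeasure m {a<..<b}}"
        by (auto simp: not_less low_def)
      then show ?thesis
        using vtheta_semicont(1)[OF ab] unfolding lower_semicont_def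
        by (metis closedin_diff closedin_topspace)
    qed
    moreover have "closedin (vtheta I) (high (a', b', d))"
    proof -
      have "high (a', b', d) = topspace (vtheta I) - {m \<in> topspace (vtheta I). emeasure m {a'..b'} < d}"
        by (auto simp: not_less high_def)
      moreover have "upper_semicont (vtheta I) (\<lambda>m. emeasure m {a'..b'})"
        using vtheta_semicont(2)[of a' I b'] ab' ab'I lt by simp
      ultimately show ?thesis
        unfolding upper_semicont_def by (metis closedin_diff closedin_topspace)
    qed
    moreover have "disjnt (low (a, b, c)) (high (a', b', d))"
    proof -
      have "\<not> (emeasure \<mu> {a<..<b} \<le> c \<and> d \<le> emeasure \<mu> {a'..b'})" if "\<mu> \<in> regular_measures I" for \<mu>
      proof -
        have "emeasure \<mu> {a'..b'} \<le> emeasure \<mu> {a<..<b}"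
          using ab' abI' by (intro regular_measures_mono[OF I that]) auto
        then show ?thesis using d(2) by (meson leD order_trans)
      qed
      then show ?thesis unfolding disjnt_iff low_def high_def by blast
    qed
    ultimately have T: "((a, b, c), (a', b', d)) \<in> T"
      using ab ab' c d by (simp add: T_def)
    show ?thesis
    proof (intro exI conjI)
      have "f (a, b, c) (a', b', d) m = 1" "f (a, b, c) (a', b', d) m' = 0"
        using f(2)[OF T] high low by blast+
      then show "f (a, b, c) (a', b', d) m \<noteq> f (a, b, c) (a', b', d) m'" by simp
    qed (rule T)
  qed
  show ?thesis
  proof (rule metrizable_space_if_countable_separating)
    show "countable ((\<lambda>(s, t). f s t) ` T)" using \<open>countable T\<close> by simp
    fix m m' assume "m \<in> topspace (vtheta I)" "m' \<in> topspace (vtheta I)" "m \<noteq> m'"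
    then have m: "m \<in> regular_measures I" "m' \<in> regular_measures I" "m \<noteq> m'" by auto
    from regular_measures_distinct[OF I interval m]
    obtain a b where ab: "a \<in> I \<inter> \<rat>" "b \<in> I \<inter> \<rat>" "a < b"
      and "emeasure m' {a..b} < emeasure m {a<..<b} \<or> emeasure m {a..b} < emeasure m' {a<..<b}" .
    from this(4) have "\<exists>s t. (s, t) \<in> T \<and> f s t m \<noteq> f s t m'"
    proof
      assume "emeasure m {a..b} < emeasure m' {a<..<b}"
      from sep[OF m(2,1) ab this] obtain s t where st: "(s, t) \<in> T" "f s t m' \<noteq> f s t m" by blast
      show ?thesis by (rule exI, rule exI, rule conjI[OF st(1) not_sym[OF st(2)]])
    qed (rule sep[OF m(1,2) ab])
    then obtain s t where "(s, t) \<in> T" "f s t m \<noteq> f s t m'" by blast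
    then show "\<exists>g\<in>(\<lambda>(s, t). f s t) ` T. g m \<noteq> g m'"
      by (intro bexI[of _ "f s t"]) (auto intro!: image_eqI[of _ _ "(s, t)"])
  qed (use f compact_space_vtheta[OF I interval] Hausdorff_space_vtheta[OF I interval] in auto)
qed

end

section \<open>Compactly supported functions\<close>

text \<open>
  A bump function: \<open>1\<close> on \<open>K\<close>, with compact support in \<open>U\<close>, and with values in \<open>[0, 1]\<close>.
\<close>

lemma bump_function:
  fixes K U :: "real set"
  assumes "compact K" "open U" "K \<subseteq> U"
  obtains \<phi> :: "real \<Rightarrow> real" where "\<phi> \<in> Cc_plus U" "\<And>x. indicator K x \<le> \<phi> x" "\<And>x. \<phi> x \<le> indicator U x"
proof -
  obtain L where L: "compact L" "K \<subseteq> interior L" "L \<subseteq> U"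
    using compact_nhd_within_open[OF assms] .
  obtain \<phi> :: "real \<Rightarrow> real" where \<phi>: "continuous_on UNIV \<phi>"
    "\<And>x. \<phi> x \<in> closed_segment 1 0" "\<And>x. x \<in> K \<Longrightarrow> \<phi> x = 1" "\<And>x. x \<in> - interior L \<Longrightarrow> \<phi> x = 0"
    using Urysohn[of K "- interior L" "1::real" 0] assms(1) L
    by (auto simp: compact_imp_closed)
  have range: "0 \<le> \<phi> x" "\<phi> x \<le> 1" for x
    using \<phi>(2)[of x] by (auto simp: closed_segment_eq_real_ivl)
  have supp: "{x. \<phi> x \<noteq> 0} \<subseteq> L" using \<phi>(4) interior_subset[of L] by blast
  then have clos: "closure {x. \<phi> x \<noteq> 0} \<subseteq> L"
    using L(1) by (intro closure_minimal) (auto simp: compact_imp_closed)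
  show ?thesis
  proof (rule that[of \<phi>])
    have "compact (closure {x. \<phi> x \<noteq> 0})"
      using compact_Int_closed[OF L(1) closed_closure] clos by (metis inf.absorb_iff2)
    then show "\<phi> \<in> Cc_plus U"
      unfolding Cc_plus_def using \<phi>(1) range clos L
      by (auto intro: continuous_on_subset simp del: compact_closure)
    show "\<phi> x \<le> indicator U x" for x
      using range[of x] supp L by (auto split: split_indicator)
    show "indicator K x \<le> \<phi> x" for x
      using range[of x] \<phi>(3)[of x] by (auto split: split_indicator)
  qed
qed

text \<open>
  A nonnegative number \<open>t \<le> N * \<epsilon>\<close> is approximated from below, with error at most \<open>\<epsilon>\<close>, by \<open>\<epsilon>\<close>
  times the number of positive multiples of \<open>\<epsilon>\<close> below \<open>t\<close>.
\<close>

lemma sum_levels_le: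
  fixes \<epsilon> t :: real
  assumes "\<epsilon> > 0" "t \<ge> 0"
  shows "(\<Sum>k<N. \<epsilon> * of_bool (Suc k * \<epsilon> \<le> t)) \<le> t"
proof -
  have "(\<Sum>k<N. \<epsilon> * of_bool (Suc k * \<epsilon> \<le> t)) \<le> min t (N * \<epsilon>)"
  proof (induction N)
    case (Suc N)
    then show ?case using assms by (auto simp: algebra_simps of_bool_def)
  qed (use assms in auto)
  then show ?thesis by simp
qed

lemma le_sum_levels:
  fixes \<epsilon> t :: real
  assumes "\<epsilon> > 0" "t \<le> N * \<epsilon>"
  shows "t \<le> \<epsilon> + (\<Sum>k<N. \<epsilon> * of_bool (Suc k * \<epsilon> < t))"
proof -
  have "min t (Suc N * \<epsilon>) \<le> \<epsilon> + (\<Sum>k<N. \<epsilon> * of_bool (Suc k * \<epsilon> < t))" for N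
  proof (induction N)
    case (Suc N)
    then show ?case using assms(1) by (auto simp: algebra_simps of_bool_def min_def split: if_splits)
  qed auto
  from this[of N] show ?thesis using assms by (simp add: algebra_simps)
qed

text \<open>
  Superlevel sets at positive heights lie in the support; continuity on \<open>U\<close> extends to the line
  because \<open>\<phi>\<close> vanishes off its support.
\<close>

lemma Cc_plus_superlevel:
  assumes U: "open U" and \<phi>: "\<phi> \<in> Cc_plus U"
  shows "continuous_on UNIV \<phi>"
    and "t > 0 \<Longrightarrow> compact {x. t \<le> \<phi> x} \<and> {x. t \<le> \<phi> x} \<subseteq> closure {x. \<phi> x \<noteq> 0}"
    and "t > 0 \<Longrightarrow> open {x. t < \<phi> x} \<and> {x. t < \<phi> x} \<subseteq> closure {x. \<phi> x \<noteq> 0}"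
proof -
  let ?S = "closure {x. \<phi> x \<noteq> 0}"
  have \<phi>': "continuous_on U \<phi>" "compact ?S" "?S \<subseteq> U" using \<phi> by (auto simp: Cc_plus_def)
  have zero: "\<phi> x = 0" if "x \<notin> ?S" for x using that closure_subset[of "{x. \<phi> x \<noteq> 0}"] by blast
  have "continuous_on (- ?S) \<phi>"
    by (rule continuous_on_eq[OF continuous_on_const[of _ 0] zero[symmetric]]) (erule ComplD)
  then have "continuous_on (U \<union> - ?S) \<phi>"
    by (rule continuous_on_open_Un[OF U open_Compl[OF closed_closure] \<phi>'(1)])
  moreover have "U \<union> - ?S = UNIV" using \<phi>' by blast
  ultimately show cont: "continuous_on UNIV \<phi>" by simp
  have sub: "{x. t \<le> \<phi> x} \<subseteq> ?S" if "t > 0" for t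
  proof -
    have "{x. t \<le> \<phi> x} \<subseteq> {x. \<phi> x \<noteq> 0}" using that by auto
    also note closure_subset
    finally show ?thesis .
  qed
  show "compact {x. t \<le> \<phi> x} \<and> {x. t \<le> \<phi> x} \<subseteq> ?S" if "t > 0"
  proof -
    have "closed {x. t \<le> \<phi> x}" by (intro closed_Collect_le continuous_on_const cont)
    then show ?thesis using compact_Int_closed[OF \<phi>'(2)] sub[OF that] by (metis inf.absorb_iff2)
  qed
  show "open {x. t < \<phi> x} \<and> {x. t < \<phi> x} \<subseteq> ?S" if "t > 0"
  proof
    show "open {x. t < \<phi> x}" by (intro open_Collect_less continuous_on_const cont)
    show "{x. t < \<phi> x} \<subseteq> ?S" using sub[OF that] by auto
  qed
qed

text \<open>
  Truncation turns one-sided bounds into limits, so that the limit laws for sums apply to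
  semicontinuous quantities.
\<close>

lemma tendsto_max_if_upper:
  fixes l :: "'a :: linorder_topology"
  assumes "\<And>c. l < c \<Longrightarrow> eventually (\<lambda>n. x n < c) F"
  shows "((\<lambda>n. max (x n) l) \<longlongrightarrow> l) F"
  by (rule order_tendstoI) (use assms in \<open>auto intro!: always_eventually simp: less_max_iff_disj\<close>)

lemma tendsto_min_if_lower:
  fixes l :: "'a :: linorder_topology"
  assumes "\<And>c. c < l \<Longrightarrow> eventually (\<lambda>n. c < x n) F"
  shows "((\<lambda>n. min (x n) l) \<longlongrightarrow> l) F"
  by (rule order_tendstoI) (use assms in \<open>auto intro!: always_eventually simp: min_less_iff_disj\<close>)

lemma emeasure_le_nn_integral_le:
  fixes \<phi> :: "real \<Rightarrow> real"
  assumes "K \<in> sets m" "U \<in> sets m" "\<And>x. indicator K x \<le> \<phi> x" "\<And>x. \<phi> x \<le> indicator U x"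
  shows "emeasure m K \<le> (\<integral>\<^sup>+x. ennreal (\<phi> x) \<partial>m)" "(\<integral>\<^sup>+x. ennreal (\<phi> x) \<partial>m) \<le> emeasure m U"
proof -
  have "indicator K x \<le> ennreal (\<phi> x)" "ennreal (\<phi> x) \<le> indicator U x" for x
    using ennreal_leI[OF assms(3)[of x]] ennreal_leI[OF assms(4)[of x]] by (auto simp: ennreal_indicator)
  then show "emeasure m K \<le> (\<integral>\<^sup>+x. ennreal (\<phi> x) \<partial>m)" "(\<integral>\<^sup>+x. ennreal (\<phi> x) \<partial>m) \<le> emeasure m U"
    using nn_integral_mono[of m "indicator K" "\<lambda>x. ennreal (\<phi> x)"]
      nn_integral_mono[of m "\<lambda>x. ennreal (\<phi> x)" "indicator U"] assms(1,2) by auto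
qed
lemma ennreal_gap:
  fixes x y :: ennreal
  assumes "x < y"
  obtains \<delta> :: real where "\<delta> > 0" "x + ennreal \<delta> < y"
proof -
  obtain z where z: "x < z" "z < y" using dense[OF assms] by blast
  then obtain r s where rs: "x = ennreal r" "z = ennreal s" "0 \<le> r" "0 \<le> s"
    by (cases x; cases z) (auto simp: top.not_eq_extremum)
  then have "r < s" using z(1) by (simp add: ennreal_less_iff)
  then have "x + ennreal (s - r) < y"
    using rs z(2) by (simp flip: ennreal_plus)
  then show ?thesis using that[of "s - r"] \<open>r < s\<close> by simp
qed

context
  fixes I :: "real set"
  assumes I: "open I"
begin

text \<open>
  Layers of height \<open>\<epsilon>\<close> bound the integral of \<open>\<phi>\<close> from both sides.  Compact superlevel sets
  will serve for the upper bound in the limit, and open ones for the lower bound.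
\<close>

lemma nn_integral_levels:
  fixes \<phi> :: "real \<Rightarrow> real" and \<epsilon> :: real and N :: nat
  assumes m: "m \<in> regular_measures I" and \<epsilon>: "\<epsilon> > 0"
    and U: "open U" "U \<subseteq> I" and \<phi>: "\<phi> \<in> Cc_plus U" "\<And>x. \<phi> x \<le> N * \<epsilon>"
  shows "(\<Sum>k<N. ennreal \<epsilon> * emeasure m {x. Suc k * \<epsilon> < \<phi> x}) \<le> (\<integral>\<^sup>+x. ennreal (\<phi> x) \<partial>m)"
    and "(\<Sum>k<N. ennreal \<epsilon> * emeasure m {x. Suc k * \<epsilon> \<le> \<phi> x}) \<le> (\<integral>\<^sup>+x. ennreal (\<phi> x) \<partial>m)"
    and "(\<integral>\<^sup>+x. ennreal (\<phi> x) \<partial>m) \<le> ennreal \<epsilon> * emeasure m (closure {x. \<phi> x \<noteq> 0})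
      + (\<Sum>k<N. ennreal \<epsilon> * emeasure m {x. Suc k * \<epsilon> < \<phi> x})"
proof -
  let ?S = "closure {x. \<phi> x \<noteq> 0}"
  have pos: "0 < Suc k * \<epsilon>" for k using \<epsilon> by simp
  have SI: "?S \<subseteq> I" using \<phi>(1) U by (auto simp: Cc_plus_def)
  note level = Cc_plus_superlevel(2,3)[OF U(1) \<phi>(1) pos]
  have sets: "{x. Suc k * \<epsilon> \<le> \<phi> x} \<in> sets m" "{x. Suc k * \<epsilon> < \<phi> x} \<in> sets m" "?S \<in> sets m" for k
    using level(1)[of k] level(2)[of k] SI closed_closure[of "{x. \<phi> x \<noteq> 0}"]
    by (simp_all only: regular_measures_sets[OF I m])
      (metis borel_compact subset_trans, metis borel_open subset_trans, metis borel_closed)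
  have meas: "(\<lambda>x. ennreal \<epsilon> * indicator A x) \<in> borel_measurable m" if "A \<in> sets m" for A
    using that by measurable
  have \<phi>0: "0 \<le> \<phi> x" for x using \<phi>(1) by (simp add: Cc_plus_def)
  have "(\<Sum>k<N. ennreal \<epsilon> * emeasure m {x. Suc k * \<epsilon> \<le> \<phi> x})
      = (\<integral>\<^sup>+x. (\<Sum>k<N. ennreal \<epsilon> * indicator {x. Suc k * \<epsilon> \<le> \<phi> x} x) \<partial>m)"
    unfolding nn_integral_sum[OF meas[OF sets(1)]] nn_integral_cmult_indicator[OF sets(1)] ..
  also have "\<dots> \<le> (\<integral>\<^sup>+x. ennreal (\<phi> x) \<partial>m)"
  proof (rule nn_integral_mono)
    fix x
    have "(\<Sum>k<N. ennreal \<epsilon> * indicator {x. Suc k * \<epsilon> \<le> \<phi> x} x)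
        = (\<Sum>k<N. ennreal (\<epsilon> * of_bool (Suc k * \<epsilon> \<le> \<phi> x)))"
      by (intro sum.cong refl) (auto split: split_indicator)
    also have "\<dots> \<le> ennreal (\<phi> x)"
      using \<epsilon> sum_levels_le[OF \<epsilon> \<phi>0] by (subst sum_ennreal) (auto intro!: ennreal_leI)
    finally show "(\<Sum>k<N. ennreal \<epsilon> * indicator {x. Suc k * \<epsilon> \<le> \<phi> x} x) \<le> ennreal (\<phi> x)" .
  qed
  finally show closed: "(\<Sum>k<N. ennreal \<epsilon> * emeasure m {x. Suc k * \<epsilon> \<le> \<phi> x}) \<le> (\<integral>\<^sup>+x. ennreal (\<phi> x) \<partial>m)" .
  have "(\<Sum>k<N. ennreal \<epsilon> * emeasure m {x. Suc k * \<epsilon> < \<phi> x})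
      \<le> (\<Sum>k<N. ennreal \<epsilon> * emeasure m {x. Suc k * \<epsilon> \<le> \<phi> x})"
    using sets by (intro sum_mono mult_left_mono emeasure_mono) auto
  also note closed
  finally show "(\<Sum>k<N. ennreal \<epsilon> * emeasure m {x. Suc k * \<epsilon> < \<phi> x}) \<le> (\<integral>\<^sup>+x. ennreal (\<phi> x) \<partial>m)" .
  have "(\<integral>\<^sup>+x. ennreal (\<phi> x) \<partial>m)
      \<le> (\<integral>\<^sup>+x. ennreal \<epsilon> * indicator ?S x + (\<Sum>k<N. ennreal \<epsilon> * indicator {x. Suc k * \<epsilon> < \<phi> x} x) \<partial>m)"
  proof (rule nn_integral_mono)
    fix x
    show "ennreal (\<phi> x) \<le> ennreal \<epsilon> * indicator ?S x + (\<Sum>k<N. ennreal \<epsilon> * indicator {x. Suc k * \<epsilon> < \<phi> x} x)"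
    proof (cases "\<phi> x = 0")
      case False
      then have x: "x \<in> ?S" using closure_subset[of "{x. \<phi> x \<noteq> 0}"] by blast
      have "ennreal (\<phi> x) \<le> ennreal (\<epsilon> + (\<Sum>k<N. \<epsilon> * of_bool (Suc k * \<epsilon> < \<phi> x)))"
        by (intro ennreal_leI le_sum_levels \<epsilon> \<phi>(2))
      also have "\<dots> = ennreal \<epsilon> + (\<Sum>k<N. ennreal (\<epsilon> * of_bool (Suc k * \<epsilon> < \<phi> x)))"
        using \<epsilon> by (subst sum_ennreal) (auto simp: sum_nonneg)
      also have "(\<Sum>k<N. ennreal (\<epsilon> * of_bool (Suc k * \<epsilon> < \<phi> x)))
          = (\<Sum>k<N. ennreal \<epsilon> * indicator {x. Suc k * \<epsilon> < \<phi> x} x)"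
        by (intro sum.cong refl) (auto split: split_indicator)
      finally show ?thesis using x by simp
    qed simp
  qed
  also have "\<dots> = ennreal \<epsilon> * emeasure m ?S + (\<Sum>k<N. ennreal \<epsilon> * emeasure m {x. Suc k * \<epsilon> < \<phi> x})"
    unfolding nn_integral_add[OF meas[OF sets(3)] borel_measurable_sum[OF meas[OF sets(2)]]]
      nn_integral_sum[OF meas[OF sets(2)]] nn_integral_cmult_indicator[OF sets(3)]
      nn_integral_cmult_indicator[OF sets(2)] ..
  finally show "(\<integral>\<^sup>+x. ennreal (\<phi> x) \<partial>m) \<le> ennreal \<epsilon> * emeasure m ?S
      + (\<Sum>k<N. ennreal \<epsilon> * emeasure m {x. Suc k * \<epsilon> < \<phi> x})" .
qed

section \<open>Explosion sets\<close>

lemma emeasure_eq_top_if_meets_explosion_set: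
  assumes m: "m \<in> regular_measures I" and U: "open U" "U \<subseteq> I" "U \<inter> explosion_set m \<noteq> {}"
  shows "emeasure m U = \<infinity>"
proof -
  obtain x where x: "x \<in> U" "x \<in> explosion_set m" using U by blast
  obtain \<epsilon> where \<epsilon>: "\<epsilon> > 0" "ball x \<epsilon> \<subseteq> U" using U(1) x(1) open_contains_ball by blast
  have "emeasure m ({x - \<epsilon><..<x + \<epsilon>} \<inter> space m) = \<infinity>"
    using x(2) \<epsilon>(1) by (auto simp: explosion_set_def)
  moreover have "{x - \<epsilon><..<x + \<epsilon>} \<inter> space m \<subseteq> U"
    using \<epsilon>(2) by (auto simp: ball_eq_greaterThanLessThan)
  then have "emeasure m ({x - \<epsilon><..<x + \<epsilon>} \<inter> space m) \<le> emeasure m U"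
    using U by (intro regular_measures_mono[OF I m]) auto
  ultimately show ?thesis by (simp add: top_unique)
qed

lemma locally_finite_off_explosion_set:
  assumes m: "m \<in> regular_measures I" and x: "x \<in> I - explosion_set m"
  obtains V where "open V" "x \<in> V" "V \<subseteq> I" "emeasure m V < \<infinity>"
proof -
  have sp: "space m = I" by (rule regular_measures_space[OF I m])
  then obtain \<epsilon> where "\<epsilon> > 0" "emeasure m ({x - \<epsilon><..<x + \<epsilon>} \<inter> I) \<noteq> \<infinity>"
    using x by (auto simp: explosion_set_def)
  then show ?thesis
    using x I by (intro that[of "{x - \<epsilon><..<x + \<epsilon>} \<inter> I"]) (auto simp: less_top)
qed

lemma open_minus_explosion_set:
  assumes m: "m \<in> regular_measures I"
  shows "open (I - explosion_set m)"
proof (subst open_subopen, intro ballI)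
  fix x assume "x \<in> I - explosion_set m"
  then obtain V where V: "open V" "x \<in> V" "V \<subseteq> I" "emeasure m V < \<infinity>"
    using locally_finite_off_explosion_set[OF m] by blast
  then have "V \<inter> explosion_set m = {}"
    using emeasure_eq_top_if_meets_explosion_set[OF m V(1,3)] by fastforce
  then show "\<exists>T. open T \<and> x \<in> T \<and> T \<subseteq> I - explosion_set m" using V by blast
qed

lemma emeasure_compact_off_explosion_set:
  assumes m: "m \<in> regular_measures I" and K: "compact K" "K \<subseteq> I - explosion_set m"
  shows "emeasure m K < \<infinity>"
proof -
  have "\<forall>x\<in>K. \<exists>V. open V \<and> x \<in> V \<and> V \<subseteq> I \<and> emeasure m V < \<infinity>"
    using K(2) locally_finite_off_explosion_set[OF m] by (metis subsetD)
  then obtain V where V: "\<And>x. x \<in> K \<Longrightarrow> open (V x) \<and> x \<in> V x \<and> V x \<subseteq> I \<and> emeasure m (V x) < \<infinity>"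
    by metis
  obtain J where J: "J \<subseteq> K" "finite J" "K \<subseteq> (\<Union>x\<in>J. V x)"
    using compactE_image[OF K(1), of K V] V by blast
  have "emeasure m K \<le> emeasure m (\<Union>x\<in>J. V x)"
    using J V by (intro regular_measures_mono[OF I m]) (blast intro: borel_open)+
  also have "\<dots> \<le> (\<Sum>x\<in>J. emeasure m (V x))"
    using J V by (intro emeasure_subadditive_finite) (auto simp: regular_measures_sets[OF I m] subset_iff)
  also have "\<dots> < \<infinity>" using J V by (auto simp: subset_iff)
  finally show ?thesis .
qed

context
  assumes interval: "is_interval I"
begin

section \<open>Convergent sequences\<close>

lemma limitin_vtheta_if_subbasic:
  assumes m: "m \<in> regular_measures I" and ms: "\<And>n. ms n \<in> regular_measures I"
    and lower: "\<And>a b c. a \<in> I \<Longrightarrow> b \<in> I \<Longrightarrow> c < emeasure m {a<..<b} \<Longrightarrow>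
      eventually (\<lambda>n. c < emeasure (ms n) {a<..<b}) F"
    and upper: "\<And>a b c. a \<in> I \<Longrightarrow> b \<in> I \<Longrightarrow> emeasure m {a..b} < c \<Longrightarrow>
      eventually (\<lambda>n. emeasure (ms n) {a..b} < c) F"
  shows "limitin (vtheta I) ms m F"
  unfolding limitin_def topspace_vtheta
proof (intro conjI m allI impI, elim conjE)
  fix V assume "openin (vtheta I) V" and "m \<in> V"
  from this(1) have "generate_topology_on (insert (regular_measures I)
       ({{m \<in> regular_measures I. c < emeasure m {a<..<b}} | a b c.
            a \<in> I \<inter> \<rat> \<and> b \<in> I \<inter> \<rat> \<and> a < b} \<union>
        {{m \<in> regular_measures I. emeasure m {a..b} < c} | a b c.
            a \<in> I \<inter> \<rat> \<and> b \<in> I \<inter> \<rat> \<and> a \<le> b})) V"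
    unfolding vtheta_def by (rule openin_topology_generated_by)
  then show "eventually (\<lambda>n. ms n \<in> V) F" using \<open>m \<in> V\<close>
  proof induction
    case (Int A B)
    then show ?case by (auto intro: eventually_conj)
  next
    case (UN \<V>)
    then obtain A where "A \<in> \<V>" "m \<in> A" by blast
    then have "eventually (\<lambda>n. ms n \<in> A) F" by (rule UN.IH)
    then show ?case by (rule eventually_mono) (use \<open>A \<in> \<V>\<close> in blast)
  next
    case (Basis A)
    then show ?case using ms lower upper by auto
  qed simp
qed

lemma nn_integral_limitin:
  assumes lim: "limitin (vtheta I) ms m sequentially" and ms: "\<And>n. ms n \<in> regular_measures I"
    and \<phi>: "\<phi> \<in> Cc_plus (I - explosion_set m)"
  shows "(\<lambda>n. \<integral>\<^sup>+x. ennreal (\<phi> x) \<partial>ms n) \<longlonglongrightarrow> (\<integral>\<^sup>+x. ennreal (\<phi> x) \<partial>m)"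
proof -
  let ?U = "I - explosion_set m" and ?S = "closure {x. \<phi> x \<noteq> 0}"
  have m: "m \<in> regular_measures I" using lim by (simp add: limitin_def)
  have U: "open ?U" "?U \<subseteq> I" using open_minus_explosion_set[OF m] by auto
  have S: "compact ?S" "?S \<subseteq> ?U" using \<phi> by (auto simp: Cc_plus_def)
  have S_fin: "emeasure m ?S < \<infinity>" by (rule emeasure_compact_off_explosion_set[OF m S])
  have \<phi>_cont: "continuous_on UNIV \<phi>" by (rule Cc_plus_superlevel(1)[OF U(1) \<phi>])
  have lower: "eventually (\<lambda>n. c < emeasure (ms n) V) sequentially"
    if "open V" "V \<subseteq> I" "c < emeasure m V" for V c
    using lim lower_semicont_emeasure_open[OF I interval that(1,2)] that(3) m ms
    unfolding lower_semicont_def limitin_def by fastforce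
  have upper: "eventually (\<lambda>n. emeasure (ms n) K < c) sequentially"
    if "compact K" "K \<subseteq> I" "emeasure m K < c" for K c
    using lim upper_semicont_emeasure_compact[OF I interval that(1,2)] that(3) m ms
    unfolding upper_semicont_def limitin_def by fastforce
  obtain B where B: "\<And>x. \<phi> x \<le> B"
  proof -
    have "bounded (\<phi> ` ?S)"
      using S(1) \<phi>_cont by (intro compact_imp_bounded compact_continuous_image) (auto intro: continuous_on_subset)
    then obtain b where b: "\<And>x. x \<in> ?S \<Longrightarrow> \<bar>\<phi> x\<bar> \<le> b" by (auto simp: bounded_iff)
    have "\<phi> x \<le> max b 0" for x
    proof (cases "\<phi> x = 0")
      case False
      then have "x \<in> ?S" using closure_subset[of "{x. \<phi> x \<noteq> 0}"] by blast
      from b[OF this] show ?thesis by linarith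
    qed simp
    then show ?thesis by (rule that)
  qed
  \<comment> \<open>For a small mesh \<open>\<epsilon>\<close>, the error term in \<open>nn_integral_levels\<close> is at most \<open>\<delta>\<close> for \<open>m\<close>.\<close>
  have mesh: "\<exists>\<epsilon>>0. ennreal \<epsilon> * emeasure m ?S \<le> ennreal \<delta>" if "\<delta> > 0" for \<delta> :: real
  proof -
    obtain s where s: "s \<ge> 0" "emeasure m ?S = ennreal s"
      using S_fin by (cases "emeasure m ?S") auto
    have "ennreal (\<delta> / (s + 1)) * emeasure m ?S \<le> ennreal \<delta>"
      using that s by (simp add: s(2) flip: ennreal_mult) (simp add: field_simps)
    moreover have "\<delta> / (s + 1) > 0" using that s by simp
    ultimately show ?thesis by blast
  qed
  have bound: "\<exists>N::nat. \<forall>x. \<phi> x \<le> N * \<epsilon>" if "\<epsilon> > 0" for \<epsilon> :: real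
  proof -
    obtain N :: nat where "B / \<epsilon> \<le> N" using real_arch_simple by blast
    then have "B \<le> N * \<epsilon>" using that by (simp add: field_simps)
    then show ?thesis using B order_trans by blast
  qed
  show ?thesis
  proof (rule order_tendstoI)
    fix c assume c: "c < (\<integral>\<^sup>+x. ennreal (\<phi> x) \<partial>m)"
    then obtain c' where c': "c < c'" "c' < (\<integral>\<^sup>+x. ennreal (\<phi> x) \<partial>m)" using dense by blast
    obtain \<delta> :: real where \<delta>: "\<delta> > 0" "c + ennreal \<delta> < c'"
      using c'(1) by (rule ennreal_gap)
    obtain \<epsilon> where \<epsilon>: "\<epsilon> > 0" "ennreal \<epsilon> * emeasure m ?S \<le> ennreal \<delta>" using mesh[OF \<delta>(1)] by blast
    obtain N where N: "\<And>x. \<phi> x \<le> real N * \<epsilon>" using bound[OF \<epsilon>(1)] by blast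
    let ?V = "\<lambda>k. {x. Suc k * \<epsilon> < \<phi> x}"
    have V: "open (?V k)" "?V k \<subseteq> I" for k
      using Cc_plus_superlevel(3)[OF U(1) \<phi>, of "Suc k * \<epsilon>"] \<epsilon>(1) S by auto
    have "c' < ennreal \<epsilon> * emeasure m ?S + (\<Sum>k<N. ennreal \<epsilon> * emeasure m (?V k))"
      using c'(2) nn_integral_levels(3)[OF m \<epsilon>(1) U \<phi> N] by (rule less_le_trans)
    also have "\<dots> \<le> ennreal \<delta> + (\<Sum>k<N. ennreal \<epsilon> * emeasure m (?V k))"
      by (rule add_right_mono[OF \<epsilon>(2)])
    finally have "c' < ennreal \<delta> + (\<Sum>k<N. ennreal \<epsilon> * emeasure m (?V k))" .
    with \<delta>(2) have less: "c + ennreal \<delta> < ennreal \<delta> + (\<Sum>k<N. ennreal \<epsilon> * emeasure m (?V k))"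
      by (rule less_trans)
    have *: "c < (\<Sum>k<N. ennreal \<epsilon> * emeasure m (?V k))" (is "_ < ?s")
    proof (rule ccontr)
      assume "\<not> c < ?s"
      then have "ennreal \<delta> + ?s \<le> ennreal \<delta> + c" by (intro add_left_mono) simp
      then show False using less by (simp add: add.commute[of c])
    qed
    have "(\<lambda>n. \<Sum>k<N. ennreal \<epsilon> * min (emeasure (ms n) (?V k)) (emeasure m (?V k)))
        \<longlonglongrightarrow> (\<Sum>k<N. ennreal \<epsilon> * emeasure m (?V k))"
      by (intro tendsto_sum ennreal_tendsto_cmult tendsto_min_if_lower lower V) auto
    from order_tendstoD(1)[OF this *]
    show "eventually (\<lambda>n. c < (\<integral>\<^sup>+x. ennreal (\<phi> x) \<partial>ms n)) sequentially"
    proof (rule eventually_mono)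
      fix n
      assume "c < (\<Sum>k<N. ennreal \<epsilon> * min (emeasure (ms n) (?V k)) (emeasure m (?V k)))"
      also have "\<dots> \<le> (\<Sum>k<N. ennreal \<epsilon> * emeasure (ms n) (?V k))"
        by (intro sum_mono mult_left_mono) auto
      also have "\<dots> \<le> (\<integral>\<^sup>+x. ennreal (\<phi> x) \<partial>ms n)"
        by (rule nn_integral_levels(1)[OF ms \<epsilon>(1) U \<phi> N])
      finally show "c < (\<integral>\<^sup>+x. ennreal (\<phi> x) \<partial>ms n)" .
    qed
  next
    fix c assume c: "(\<integral>\<^sup>+x. ennreal (\<phi> x) \<partial>m) < c"
    obtain \<delta> :: real where \<delta>: "\<delta> > 0" "(\<integral>\<^sup>+x. ennreal (\<phi> x) \<partial>m) + ennreal \<delta> < c"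
      using c by (rule ennreal_gap)
    obtain \<epsilon> where \<epsilon>: "\<epsilon> > 0" "ennreal \<epsilon> * emeasure m ?S \<le> ennreal \<delta>" using mesh[OF \<delta>(1)] by blast
    obtain N where N: "\<And>x. \<phi> x \<le> real N * \<epsilon>" using bound[OF \<epsilon>(1)] by blast
    let ?K = "\<lambda>k. {x. Suc k * \<epsilon> \<le> \<phi> x}" and ?V = "\<lambda>k. {x. Suc k * \<epsilon> < \<phi> x}"
    have K: "compact (?K k)" "?K k \<subseteq> I" for k
      using Cc_plus_superlevel(2)[OF U(1) \<phi>, of "Suc k * \<epsilon>"] \<epsilon>(1) S by auto
    have SI: "?S \<subseteq> I" using S by auto
    have "ennreal \<epsilon> * emeasure m ?S + (\<Sum>k<N. ennreal \<epsilon> * emeasure m (?K k))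
        \<le> ennreal \<delta> + (\<integral>\<^sup>+x. ennreal (\<phi> x) \<partial>m)"
      by (intro add_mono \<epsilon>(2) nn_integral_levels(2)[OF m \<epsilon>(1) U \<phi> N])
    also have "\<dots> < c" using \<delta>(2) by (simp add: add.commute)
    finally have *: "ennreal \<epsilon> * emeasure m ?S + (\<Sum>k<N. ennreal \<epsilon> * emeasure m (?K k)) < c" .
    have "(\<lambda>n. ennreal \<epsilon> * max (emeasure (ms n) ?S) (emeasure m ?S)
          + (\<Sum>k<N. ennreal \<epsilon> * max (emeasure (ms n) (?K k)) (emeasure m (?K k))))
        \<longlonglongrightarrow> ennreal \<epsilon> * emeasure m ?S + (\<Sum>k<N. ennreal \<epsilon> * emeasure m (?K k))"
      by (intro tendsto_add tendsto_sum ennreal_tendsto_cmult tendsto_max_if_upper upper K S SI) auto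
    from order_tendstoD(2)[OF this *]
    show "eventually (\<lambda>n. (\<integral>\<^sup>+x. ennreal (\<phi> x) \<partial>ms n) < c) sequentially"
    proof (rule eventually_mono)
      fix n
      have "(\<integral>\<^sup>+x. ennreal (\<phi> x) \<partial>ms n)
          \<le> ennreal \<epsilon> * emeasure (ms n) ?S + (\<Sum>k<N. ennreal \<epsilon> * emeasure (ms n) (?V k))"
        by (rule nn_integral_levels(3)[OF ms \<epsilon>(1) U \<phi> N])
      also have "\<dots> \<le> ennreal \<epsilon> * max (emeasure (ms n) ?S) (emeasure m ?S)
          + (\<Sum>k<N. ennreal \<epsilon> * max (emeasure (ms n) (?K k)) (emeasure m (?K k)))"
      proof (intro add_mono sum_mono mult_left_mono)
        fix k
        have "emeasure (ms n) (?V k) \<le> emeasure (ms n) (?K k)"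
          using K by (intro regular_measures_mono[OF I ms]) (auto intro: borel_compact)
        then show "emeasure (ms n) (?V k) \<le> max (emeasure (ms n) (?K k)) (emeasure m (?K k))"
          by (simp add: le_max_iff_disj)
      qed auto
      also assume "\<dots> < c"
      finally show "(\<integral>\<^sup>+x. ennreal (\<phi> x) \<partial>ms n) < c" .
    qed
  qed
qed

lemma limitin_vtheta_if:
  assumes m: "m \<in> regular_measures I" and ms: "\<And>n. ms n \<in> regular_measures I"
    and expl: "\<And>U. open U \<Longrightarrow> U \<subseteq> I \<Longrightarrow> U \<inter> explosion_set m \<noteq> {} \<Longrightarrow>
      (\<lambda>n. emeasure (ms n) U) \<longlonglongrightarrow> \<infinity>"
    and int: "\<And>\<phi>. \<phi> \<in> Cc_plus (I - explosion_set m) \<Longrightarrow>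
      (\<lambda>n. \<integral>\<^sup>+x. ennreal (\<phi> x) \<partial>ms n) \<longlonglongrightarrow> (\<integral>\<^sup>+x. ennreal (\<phi> x) \<partial>m)"
  shows "limitin (vtheta I) ms m sequentially"
proof (rule limitin_vtheta_if_subbasic[OF m ms])
  have Cc_mono: "\<phi> \<in> Cc_plus (I - explosion_set m)"
    if "\<phi> \<in> Cc_plus U" "open U" "U \<subseteq> I - explosion_set m" for \<phi> U
    using that Cc_plus_superlevel(1)[OF that(2,1)] by (auto simp: Cc_plus_def intro: continuous_on_subset)
  fix a b c assume ab: "a \<in> I" "b \<in> I"
  {
    assume c: "c < emeasure m {a<..<b}"
    have sub: "{a<..<b} \<subseteq> I" using Icc_subset_interval[OF I interval ab] by auto
    show "eventually (\<lambda>n. c < emeasure (ms n) {a<..<b}) sequentially"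
    proof (cases "{a<..<b} \<inter> explosion_set m = {}")
      case False
      have "c < \<infinity>" by (rule less_le_trans[OF c]) simp
      then show ?thesis
        using order_tendstoD(1)[OF expl[OF open_greaterThanLessThan sub False]] by blast
    next
      case True
      from c obtain K where K: "compact K" "K \<subseteq> {a<..<b}" "c < emeasure m K"
        unfolding regular_measures_inner[OF I m borel_open[OF open_greaterThanLessThan] sub] less_SUP_iff
        by blast
      obtain \<phi> :: "real \<Rightarrow> real" where \<phi>: "\<phi> \<in> Cc_plus {a<..<b}" "\<And>x. indicator K x \<le> \<phi> x" "\<And>x. \<phi> x \<le> indicator {a<..<b} x"
        using bump_function[OF K(1) open_greaterThanLessThan K(2)] by metis
      have sets: "K \<in> sets \<mu>" "{a<..<b} \<in> sets \<mu>" if "\<mu> \<in> regular_measures I" for \<mu>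
        using K sub by (auto simp: regular_measures_sets[OF I that] borel_compact)
      note le = emeasure_le_nn_integral_le[OF sets \<phi>(2,3)]
      have "c < (\<integral>\<^sup>+x. ennreal (\<phi> x) \<partial>m)" using K(3) le(1)[OF m m] by (rule less_le_trans)
      moreover have "\<phi> \<in> Cc_plus (I - explosion_set m)"
        using True sub by (intro Cc_mono[OF \<phi>(1)]) auto
      ultimately have "eventually (\<lambda>n. c < (\<integral>\<^sup>+x. ennreal (\<phi> x) \<partial>ms n)) sequentially"
        using order_tendstoD(1)[OF int] by blast
      then show ?thesis
        by (rule eventually_mono) (use le(2)[OF ms ms] in \<open>blast intro: less_le_trans\<close>)
    qed
  }
  {
    assume c: "emeasure m {a..b} < c"
    have sub: "{a..b} \<subseteq> I" by (rule Icc_subset_interval[OF I interval ab])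
    from c obtain U where U: "open U" "U \<subseteq> I" "{a..b} \<subseteq> U" "emeasure m U < c"
      unfolding regular_measures_outer[OF I m borel_closed[OF closed_atLeastAtMost] sub] INF_less_iff
      by blast
    then have "emeasure m U \<noteq> \<infinity>" by auto
    then have disj: "U \<subseteq> I - explosion_set m"
      using emeasure_eq_top_if_meets_explosion_set[OF m U(1,2)] U(2) by blast
    obtain \<phi> :: "real \<Rightarrow> real" where \<phi>: "\<phi> \<in> Cc_plus U" "\<And>x. indicator {a..b} x \<le> \<phi> x" "\<And>x. \<phi> x \<le> indicator U x"
      using bump_function[OF compact_Icc U(1,3)] by metis
    have sets: "{a..b} \<in> sets \<mu>" "U \<in> sets \<mu>" if "\<mu> \<in> regular_measures I" for \<mu>
      using U sub by (auto simp: regular_measures_sets[OF I that])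
    note le = emeasure_le_nn_integral_le[OF sets \<phi>(2,3)]
    have "(\<integral>\<^sup>+x. ennreal (\<phi> x) \<partial>m) < c" using le(2)[OF m m] U(4) by (rule le_less_trans)
    then have "eventually (\<lambda>n. (\<integral>\<^sup>+x. ennreal (\<phi> x) \<partial>ms n) < c) sequentially"
      using order_tendstoD(2)[OF int[OF Cc_mono[OF \<phi>(1) U(1) disj]]] by blast
    then show "eventually (\<lambda>n. emeasure (ms n) {a..b} < c) sequentially"
      by (rule eventually_mono) (use le(1)[OF ms ms] in \<open>blast intro: le_less_trans\<close>)
  }
qed

end

end

theorem proposition4p1:
  fixes \<alpha> \<beta> :: ereal and I :: "real set"
  assumes "\<alpha> < \<beta>" and "I = einterval \<alpha> \<beta>"
  shows "metrizable_space (vtheta I) \<and>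
    compact_space (vtheta I) \<and>
    (\<forall>U. open U \<and> U \<subseteq> I \<longrightarrow> lower_semicont (vtheta I) (\<lambda>m. emeasure m U)) \<and>
    (\<forall>K. compact K \<and> K \<subseteq> I \<longrightarrow> upper_semicont (vtheta I) (\<lambda>m. emeasure m K)) \<and>
    (\<forall>(ms :: nat \<Rightarrow> real measure) m.
       (\<forall>n. ms n \<in> regular_measures I) \<and> m \<in> regular_measures I \<longrightarrow>
         (limitin (vtheta I) ms m sequentially \<longleftrightarrow>
           (\<forall>U. open U \<and> U \<subseteq> I \<and> U \<inter> explosion_set m \<noteq> {} \<longrightarrow>
              (\<lambda>n. emeasure (ms n) U) \<longlonglongrightarrow> \<infinity>) \<and>
           (\<forall>\<phi> \<in> Cc_plus (I - explosion_set m).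
              (\<lambda>n. \<integral>\<^sup>+x. ennreal (\<phi> x) \<partial>ms n) \<longlonglongrightarrow> (\<integral>\<^sup>+x. ennreal (\<phi> x) \<partial>m))))"
proof -
  have I: "open I" using assms(2) by simp
  have interval: "is_interval I"
    unfolding is_interval_1 assms(2) by (auto simp: einterval_iff)
      (meson ereal_less_eq(3) less_le_trans, meson ereal_less_eq(3) le_less_trans)
  have lower: "lower_semicont (vtheta I) (\<lambda>m. emeasure m U)" if "open U" "U \<subseteq> I" for U
    using that by (rule lower_semicont_emeasure_open[OF I interval])
  have expl: "(\<lambda>n. emeasure (ms n) U) \<longlonglongrightarrow> \<infinity>"
    if ms: "\<And>n. ms n \<in> regular_measures I" and lim: "limitin (vtheta I) ms m sequentially"
      and U: "open U" "U \<subseteq> I" "U \<inter> explosion_set m \<noteq> {}" for ms :: "nat \<Rightarrow> real measure" and m U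
  proof (rule order_tendstoI)
    have m: "m \<in> regular_measures I" using lim by (simp add: limitin_def)
    fix c :: ennreal assume "c < \<infinity>"
    then have "m \<in> {m \<in> topspace (vtheta I). c < emeasure m U}"
      using emeasure_eq_top_if_meets_explosion_set[OF I m U] m by simp
    then have "eventually (\<lambda>n. ms n \<in> {m \<in> topspace (vtheta I). c < emeasure m U}) sequentially"
      using lim lower[OF U(1,2)] unfolding limitin_def lower_semicont_def by blast
    then show "eventually (\<lambda>n. c < emeasure (ms n) U) sequentially"
      by (rule eventually_mono) simp
  qed simp
  show ?thesis
  proof (intro conjI allI impI iffI ballI; (elim conjE)?)
    show "metrizable_space (vtheta I)" by (rule metrizable_space_vtheta[OF I interval])
    show "compact_space (vtheta I)" by (rule compact_space_vtheta[OF I interval])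
    show "lower_semicont (vtheta I) (\<lambda>m. emeasure m U)" if "open U" "U \<subseteq> I" for U
      by (rule lower[OF that])
    show "upper_semicont (vtheta I) (\<lambda>m. emeasure m K)" if "compact K" "K \<subseteq> I" for K
      by (rule upper_semicont_emeasure_compact[OF I interval that])
  next
    fix ms :: "nat \<Rightarrow> real measure" and m
    assume ms: "\<forall>n. ms n \<in> regular_measures I" and m: "m \<in> regular_measures I"
    {
      assume lim: "limitin (vtheta I) ms m sequentially"
      show "(\<lambda>n. emeasure (ms n) U) \<longlonglongrightarrow> \<infinity>" if "open U" "U \<subseteq> I" "U \<inter> explosion_set m \<noteq> {}" for U
        by (rule expl[OF _ lim that]) (use ms in blast)
      show "(\<lambda>n. \<integral>\<^sup>+x. ennreal (\<phi> x) \<partial>ms n) \<longlonglongrightarrow> (\<integral>\<^sup>+x. ennreal (\<phi> x) \<partial>m)"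
        if "\<phi> \<in> Cc_plus (I - explosion_set m)" for \<phi>
        by (rule nn_integral_limitin[OF I interval lim _ that]) (use ms in blast)
    }
    assume "\<forall>U. open U \<and> U \<subseteq> I \<and> U \<inter> explosion_set m \<noteq> {} \<longrightarrow>
              (\<lambda>n. emeasure (ms n) U) \<longlonglongrightarrow> \<infinity>"
      and "\<forall>\<phi> \<in> Cc_plus (I - explosion_set m).
              (\<lambda>n. \<integral>\<^sup>+x. ennreal (\<phi> x) \<partial>ms n) \<longlonglongrightarrow> (\<integral>\<^sup>+x. ennreal (\<phi> x) \<partial>m)"
    with ms show "limitin (vtheta I) ms m sequentially"
      by (intro limitin_vtheta_if[OF I interval m]) blast+
  qed
qed

end
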